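(* Let $X_1,\dots,X_n,Z$ be absolutely continuous random variables such that $X_1,\dots,X_n$ are conditionally independent given $Z$. Let $F_{X_i}$ be the distribution function of $X_i$, let $C_{X_i,Z}$ be the copula of $(X_i,Z)$, and write $\dot C_{X_i,Z}(u,w)=\frac{\partial}{\partial w}C_{X_i,Z}(u,w)$. Let $X_{1:n}\le\dots\le X_{n:n}$ be the order statistics of $X_1,\dots,X_n$. Then for $1\le r\le n$ and $x\in\mathbb{R}$, $$P\{X_{r:n}\le x\}=\sum_{i=r}^n\frac{1}{i!(n-i)!}\sum_{(j_1,\dots,j_n)\in S_n}\int_0^1\left\{\prod_{l=1}^i\dot C_{X_{j_l},Z}(F_{X_{j_l}}(x),s)\prod_{l=i+1}^n\left[1-\dot C_{X_{j_l},Z}(F_{X_{j_l}}(x),s)\right]\right\}ds,$$ where $S_n$ is the set of all $n!$ permutations $(j_1,\dots,j_n)$ of $(1,2,\dots,n)$.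
   Context: Let $F_Z$ be the distribution function of $Z$. The copula $C_{X_i,Z}$ is the distribution function on $[0,1]^2$ with uniform margins such that $P\{X_i\le x,Z\le z\}=C_{X_i,Z}(F_{X_i}(x),F_Z(z))$ for all real $x,z$. The random variables $X_1,\dots,X_n$ are said to be conditionally independent given $Z$ if $$P\{X_1\le x_1,\dots,X_n\le x_n\mid Z=z\}=\prod_{i=1}^nP\{X_i\le x_i\mid Z=z\}$$ for all $(x_1,\dots,x_n,z)\in\mathbb{R}^{n+1}$. Empty products equal $1$. *)

theory Defs
  imports "HOL-Probability.Probability" "HOL-Combinatorics.Permutations"
begin

definition abs_cont_rv :: "'a measure \<Rightarrow> ('a \<Rightarrow> real) \<Rightarrow> bool" where
  "abs_cont_rv M X \<longleftrightarrow> (\<exists>f. distributed M lborel X f)"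

definition dist_fun :: "'a measure \<Rightarrow> ('a \<Rightarrow> real) \<Rightarrow> real \<Rightarrow> real" where
  "dist_fun M X = cdf (distr M borel X)"

(* P(A | Z = z) as a function of z: the Radon-Nikodym derivative of
   B |-> P(A \<inter> {Z \<in> B}) with respect to the distribution of Z.
   It is determined only up to a null set of the distribution of Z. *)
definition cond_prob_at :: "'a measure \<Rightarrow> ('a \<Rightarrow> real) \<Rightarrow> 'a set \<Rightarrow> real \<Rightarrow> real" where
  "cond_prob_at M Z A z =
     enn2real (RN_deriv (distr M borel Z) (distr (density M (indicator A)) borel Z) z)"

(* The identity is required for all thresholds x_1, ..., x_n and, as conditional
   probabilities given Z = z are versions, for almost every z in the distribution of Z.
   Only the values x i with 1 \<le> i \<le> n matter. *)
definition cond_indep_given ::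
  "'a measure \<Rightarrow> nat \<Rightarrow> (nat \<Rightarrow> 'a \<Rightarrow> real) \<Rightarrow> ('a \<Rightarrow> real) \<Rightarrow> bool" where
  "cond_indep_given M n X Z \<longleftrightarrow>
     (\<forall>x :: nat \<Rightarrow> real. AE z in distr M borel Z.
        cond_prob_at M Z {\<omega> \<in> space M. \<forall>i\<in>{1..n}. X i \<omega> \<le> x i} z =
        (\<Prod>i=1..n. cond_prob_at M Z {\<omega> \<in> space M. X i \<omega> \<le> x i} z))"

(* Only the values of C on the unit square are constrained. *)
definition is_copula :: "(real \<Rightarrow> real \<Rightarrow> real) \<Rightarrow> bool" where
  "is_copula C \<longleftrightarrow>
     (\<exists>\<nu> :: (real \<times> real) measure. prob_space \<nu> \<and> sets \<nu> = sets borel \<and>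
        distr \<nu> borel fst = uniform_measure lborel {0..1} \<and>
        distr \<nu> borel snd = uniform_measure lborel {0..1} \<and>
        (\<forall>u\<in>{0..1}. \<forall>w\<in>{0..1}. C u w = measure \<nu> ({..u} \<times> {..w})))"

definition copula_of ::
  "'a measure \<Rightarrow> ('a \<Rightarrow> real) \<Rightarrow> ('a \<Rightarrow> real) \<Rightarrow> (real \<Rightarrow> real \<Rightarrow> real) \<Rightarrow> bool" where
  "copula_of M X Z C \<longleftrightarrow> is_copula C \<and>
     (\<forall>x z. \<P>(\<omega> in M. X \<omega> \<le> x \<and> Z \<omega> \<le> z) = C (dist_fun M X x) (dist_fun M Z z))"

(* For a copula C and u in [0,1] the derivative exists for almost every w in [0,1];
   elsewhere the value is an arbitrary constant. *)
definition copula_dot :: "(real \<Rightarrow> real \<Rightarrow> real) \<Rightarrow> real \<Rightarrow> real \<Rightarrow> real" where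
  "copula_dot C u w = deriv (\<lambda>v. C u v) w"

definition order_stat :: "nat \<Rightarrow> (nat \<Rightarrow> 'a \<Rightarrow> real) \<Rightarrow> nat \<Rightarrow> 'a \<Rightarrow> real" where
  "order_stat n X r \<omega> = sort (map (\<lambda>i. X i \<omega>) [1..<Suc n]) ! (r - 1)"

end

theory Submission
  imports Defs
begin

text \<open>
  The r-th order statistic is at most x iff at least r of the variables are at most x. Splitting
  this event according to the exact index set S of the variables that are at most x, its probability
  is the sum over all S with at least r elements of P(exactly S). By conditional independence,
  P(exactly S) is the integral over the distribution of Z of the product of P(X_i \<le> x | Z = z) over
  i in S and of 1 - P(X_i \<le> x | Z = z) over the other i
  (\<open>cond_indep_given_complements\<close>).

  The copula enters through P(X_i \<le> x | Z = z) = D_i(F_Z(z)) for almost every z, where D_i(s) is the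
  partial derivative of the copula of (X_i, Z) at (F_i(x), s), F_i denoting the distribution function
  of X_i (\<open>cond_prob_at_eq_copula_density\<close>).
  Since F_Z is continuous, F_Z(Z) is uniform on [0,1] (\<open>distr_cdf\<close>), and the integral over z becomes
  an integral over s in [0,1]. That the copula is recovered from its partial derivative rests on the
  Lebesgue differentiation theorem on the line, derived here from the Vitali covering theorem
  (\<open>AE_has_derivative_indefinite_integral\<close>).

  Finally the sum over subsets of size i is written as a sum over permutations: each subset is the
  image of the first i indices under i! (n - i)! permutations (\<open>card_permutes_image_eq\<close>), which is the
  factor in front of the inner sum.
\<close>

section \<open>Lebesgue differentiation on the line\<close>

text \<open>The measure with density h vanishes on the zero set A of h, so by outer regularity A lies in
  an open set U of arbitrarily small measure. At each exceptional point short intervals inside U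
  carry measure more than c times their length; a disjoint Vitali selection of such intervals
  covers the exceptional set up to a null set and has total length at most the measure of U
  divided by c.\<close>

lemma negligible_positive_upper_density:
  fixes h :: "real \<Rightarrow> real"
  assumes h: "integrable lborel h" and nn: "\<And>t. 0 \<le> h t" and c: "0 < c"
  shows "negligible {x. h x = 0 \<and> (\<forall>d>0. \<exists>a b. a < b \<and> x \<in> {a..b} \<and> b - a < d \<and>
            c * (b - a) < (LINT t:{a..b}|lborel. h t))}" (is "negligible ?E")
proof -
  have [measurable]: "h \<in> borel_measurable borel"
    using h by auto
  define \<nu> where "\<nu> = density lborel (\<lambda>t. ennreal (h t))"
  have sets_\<nu>[measurable_cong, simp]: "sets \<nu> = sets borel" and space_\<nu>[simp]: "space \<nu> = UNIV"
    by (simp_all add: \<nu>_def)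
  have fin: "emeasure \<nu> (space \<nu>) \<noteq> \<infinity>"
    using h nn by (simp add: \<nu>_def emeasure_density nn_integral_eq_integral)
  have \<nu>_int: "emeasure \<nu> {a..b} = ennreal (LINT t:{a..b}|lborel. h t)" for a b
    using h nn unfolding \<nu>_def set_lebesgue_integral_def
    by (subst emeasure_density)
       (auto simp: nn_integral_eq_integral[symmetric] integrable_real_mult_indicator
         ennreal_mult' ennreal_indicator mult.commute intro!: nn_integral_cong)
  define A where "A = {x. h x = 0}"
  have A[measurable]: "A \<in> sets borel"
    unfolding A_def by measurable
  have "emeasure \<nu> A = 0"
    unfolding \<nu>_def by (subst emeasure_density) (auto simp: A_def indicator_def intro!: nn_integral_zero' AE_I2)
  show ?thesis
  proof (rule negligible_outer_le[THEN iffD2], intro allI impI)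
    fix e :: real assume e: "0 < e"
    have "(INF U \<in> {U. A \<subseteq> U \<and> open U}. emeasure \<nu> U) < ennreal (c * e)"
      using outer_regular[OF sets_\<nu> fin A] \<open>emeasure \<nu> A = 0\<close> c e by simp
    then obtain U where U: "A \<subseteq> U" "open U" and \<nu>U: "emeasure \<nu> U < ennreal (c * e)"
      by (auto simp: INF_less_iff)
    define K where "K = {(a, b). a < b \<and> {a..b} \<subseteq> U \<and> c * (b - a) < (LINT t:{a..b}|lborel. h t)}"
    define m where "m = (\<lambda>(a::real, b). (a + b) / 2)"
    define \<rho> where "\<rho> = (\<lambda>(a::real, b). (b - a) / 2)"
    have cb: "cball (m i) (\<rho> i) = {fst i..snd i}" for i
      by (cases i) (auto simp: m_def \<rho>_def cball_eq_atLeastAtMost field_simps)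
    obtain C where C: "countable C" "C \<subseteq> K"
      and disj: "pairwise (\<lambda>i j. disjnt (cball (m i) (\<rho> i)) (cball (m j) (\<rho> j))) C"
      and neg: "negligible (?E - (\<Union>i\<in>C. cball (m i) (\<rho> i)))"
    proof (rule Vitali_covering_theorem_cballs[of K \<rho> ?E m])
      show "0 < \<rho> i" if "i \<in> K" for i
        using that by (auto simp: K_def \<rho>_def)
      fix x d :: real assume x: "x \<in> ?E" and d: "0 < d"
      have "x \<in> U" using x U(1) by (auto simp: A_def)
      then obtain d' where d': "0 < d'" "ball x d' \<subseteq> U"
        using U(2) open_contains_ball by blast
      obtain a b where ab: "a < b" "x \<in> {a..b}" "b - a < min d d'"
          "c * (b - a) < (LINT t:{a..b}|lborel. h t)"
        using x d d'(1) by (auto dest!: spec[of _ "min d d'"])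
      have "{a..b} \<subseteq> ball x d'"
        using ab by (auto simp: dist_real_def)
      then have "(a, b) \<in> K"
        using ab d' by (auto simp: K_def)
      moreover have "x \<in> cball (m (a, b)) (\<rho> (a, b))"
        using ab by (simp add: cb)
      moreover have "\<rho> (a, b) < d"
        using ab by (auto simp: \<rho>_def)
      ultimately show "\<exists>i. i \<in> K \<and> x \<in> cball (m i) (\<rho> i) \<and> \<rho> i < d"
        by blast
    qed auto
    define V where "V = (\<Union>i\<in>C. {fst i..snd i})"
    have V[measurable]: "V \<in> sets borel"
      unfolding V_def using C(1) by (intro sets.countable_UN') auto
    have "{fst i..snd i} \<subseteq> U" if "i \<in> C" for i
      using subsetD[OF C(2) that] by (auto simp: K_def)
    then have VU: "V \<subseteq> U"
      by (auto simp: V_def)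
    have dj: "disjoint_family_on (\<lambda>i. {fst i..snd i}) C"
      using disj unfolding disjoint_family_on_def pairwise_def disjnt_def cb by blast
    have "c * emeasure lborel V = c * (\<integral>\<^sup>+i. emeasure lborel {fst i..snd i} \<partial>count_space C)"
      unfolding V_def using C(1) dj by (subst emeasure_UN_countable) auto
    also have "\<dots> = (\<integral>\<^sup>+i. c * emeasure lborel {fst i..snd i} \<partial>count_space C)"
      by (subst nn_integral_cmult) auto
    also have "\<dots> \<le> (\<integral>\<^sup>+i. emeasure \<nu> {fst i..snd i} \<partial>count_space C)"
    proof (rule nn_integral_mono)
      fix i assume "i \<in> space (count_space C)"
      then have "i \<in> K" using C(2) by auto
      then show "c * emeasure lborel {fst i..snd i} \<le> emeasure \<nu> {fst i..snd i}"
        using c by (auto simp: K_def \<nu>_int ennreal_mult[symmetric] intro!: ennreal_leI)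
    qed
    also have "\<dots> = emeasure \<nu> V"
      unfolding V_def using C(1) dj by (subst emeasure_UN_countable) auto
    also have "\<dots> \<le> emeasure \<nu> U"
      using U(2) VU by (intro emeasure_mono) auto
    also note \<nu>U
    finally have lt: "ennreal c * emeasure lborel V < ennreal c * ennreal e"
      using c e by (simp add: ennreal_mult)
    then have le: "emeasure lborel V < ennreal e"
      by (metis leD leI mult_left_mono zero_le)
    have Vm: "V \<in> lmeasurable"
      using le by (auto simp: fmeasurable_def intro: less_trans[OF _ ennreal_less_top])
    define N where "N = ?E - V"
    have N: "negligible N"
      using neg unfolding N_def V_def cb .
    have i1: "?E \<subseteq> V \<union> N" by (auto simp: N_def)
    have i2: "V \<union> N \<in> lmeasurable"
      using Vm N by (simp add: fmeasurable.Un negligible_imp_measurable)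
    have i3: "measure lebesgue (V \<union> N) = measure lebesgue V"
      using N Vm by (intro measure_negligible_symdiff) (auto simp: fmeasurableD intro: negligible_subset)
    have i4: "measure lebesgue V \<le> e"
      using le e by (simp add: measure_def enn2real_leI)
    show "\<exists>T. ?E \<subseteq> T \<and> T \<in> lmeasurable \<and> measure lebesgue T \<le> e"
      by (intro exI[of _ "V \<union> N"] conjI i1 i2) (simp only: i3 i4)
  qed
qed

text \<open>Below a rational level q slightly above f(x), the positive part of f - q vanishes at x, hence
  has small averages near x by the previous lemma. Countably many levels and tolerances serve all
  points at once, and this bounds the averages of f from above.\<close>

lemma AE_average_excess_small:
  fixes f :: "real \<Rightarrow> real"
  assumes f: "set_integrable lborel {\<alpha>..\<beta>} f"
  shows "AE x in lborel. x \<in> {\<alpha><..<\<beta>} \<longrightarrow> (\<forall>e>0. \<exists>d>0. \<forall>a b. a < b \<longrightarrow> x \<in> {a..b} \<longrightarrow> b - a < d \<longrightarrow>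
           {a..b} \<subseteq> {\<alpha>..\<beta>} \<and> (LINT t:{a..b}|lborel. f t) \<le> (f x + e) * (b - a))"
proof -
  \<comment> \<open>Cut off outside the interval, since f is only assumed integrable there and the constant q is not
    integrable on the whole line.\<close>
  define h where "h = (\<lambda>(q::rat) t. max 0 (indicator {\<alpha>..\<beta>} t *\<^sub>R f t - of_rat q * indicator {\<alpha>..\<beta>} t))"
  have hi: "integrable lborel (h q)" for q
    using f unfolding h_def set_integrable_def
    by (intro integrable_max Bochner_Integration.integrable_diff integrable_zero)
       (auto intro!: integrable_mult_right integrable_real_indicator simp: emeasure_lborel_Icc_eq)
  have hn: "0 \<le> h q t" for q t
    by (simp add: h_def)
  define E where "E = (\<lambda>q (k::nat). {x. h q x = 0 \<and> (\<forall>d>0. \<exists>a b. a < b \<and> x \<in> {a..b} \<and> b - a < d \<and>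
            (1 / Suc k) * (b - a) < (LINT t:{a..b}|lborel. h q t))})"
  have "negligible (E q k)" for q k
    unfolding E_def by (rule negligible_positive_upper_density[OF hi hn]) auto
  then have "AE x in lebesgue. x \<notin> E q k" for q k
    by (simp add: AE_not_in negligible_iff_null_sets)
  then have "AE x in lborel. x \<notin> E q k" for q k
    by (simp add: AE_completion_iff)
  then have "AE x in lborel. \<forall>q k. x \<notin> E q k"
    by (simp add: AE_all_countable)
  then show ?thesis
  proof (eventually_elim, intro impI allI)
    fix x e :: real
    assume x: "\<forall>q k. x \<notin> E q k" and xin: "x \<in> {\<alpha><..<\<beta>}" and e: "0 < e"
    obtain q where q: "f x < of_rat q" "of_rat q < f x + e / 2"
      using of_rat_dense[of "f x" "f x + e / 2"] e by auto
    obtain k where k: "1 / Suc k < e / 2"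
      using e by (metis half_gt_zero nat_approx_posE)
    have "h q x = 0" using q xin by (auto simp: h_def)
    moreover have "x \<notin> E q k" using x by blast
    ultimately obtain d where d: "0 < d" and D: "\<And>a b. a < b \<Longrightarrow> x \<in> {a..b} \<Longrightarrow> b - a < d \<Longrightarrow>
            (LINT t:{a..b}|lborel. h q t) \<le> (1 / Suc k) * (b - a)"
      unfolding E_def mem_Collect_eq not_less[symmetric] by blast
    define d' where "d' = min d (min (x - \<alpha>) (\<beta> - x))"
    have "0 < d'" using d xin by (auto simp: d'_def)
    moreover have "{a..b} \<subseteq> {\<alpha>..\<beta>} \<and> (LINT t:{a..b}|lborel. f t) \<le> (f x + e) * (b - a)"
      if ab: "a < b" "x \<in> {a..b}" "b - a < d'" for a b
    proof
      show sub: "{a..b} \<subseteq> {\<alpha>..\<beta>}"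
        using ab by (auto simp: d'_def)
      have hq: "set_integrable lborel {a..b} (h q)"
        using integrable_mult_indicator[OF _ hi] by (simp add: set_integrable_def)
      have cq: "set_integrable lborel {a..b} (\<lambda>t. of_rat q :: real)"
        unfolding set_integrable_def
        by (auto intro!: integrable_mult_right integrable_real_indicator simp: emeasure_lborel_Icc_eq)
      have "(LINT t:{a..b}|lborel. f t) \<le> (LINT t:{a..b}|lborel. h q t + of_rat q)"
      proof (rule set_integral_mono)
        show "set_integrable lborel {a..b} f"
          using sub by (intro set_integrable_subset[OF f]) auto
        show "set_integrable lborel {a..b} (\<lambda>t. h q t + of_rat q)"
          by (intro set_integral_add hq cq)
        show "f t \<le> h q t + of_rat q" if "t \<in> {a..b}" for t
          using sub that by (auto simp: h_def indicator_def)
      qed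
      also have "\<dots> = (LINT t:{a..b}|lborel. h q t) + of_rat q * (b - a)"
        using ab by (subst set_integral_add[OF hq cq]) (simp add: set_lebesgue_integral_def)
      also have "\<dots> \<le> (1 / Suc k) * (b - a) + of_rat q * (b - a)"
        using D[of a b] ab by (simp add: d'_def)
      also have "\<dots> = (1 / Suc k + of_rat q) * (b - a)"
        by (simp add: algebra_simps)
      also have "\<dots> \<le> (f x + e) * (b - a)"
        using ab(1) q k by (intro mult_right_mono) auto
      finally show "(LINT t:{a..b}|lborel. f t) \<le> (f x + e) * (b - a)" .
    qed
    ultimately show "\<exists>d>0. \<forall>a b. a < b \<longrightarrow> x \<in> {a..b} \<longrightarrow> b - a < d \<longrightarrow>
           {a..b} \<subseteq> {\<alpha>..\<beta>} \<and> (LINT t:{a..b}|lborel. f t) \<le> (f x + e) * (b - a)"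
      by blast
  qed
qed

text \<open>The Lebesgue differentiation theorem on the line: the one-sided bound applied to f and to -f
  squeezes the difference quotients of the indefinite integral.\<close>

theorem AE_has_derivative_indefinite_integral:
  fixes f :: "real \<Rightarrow> real"
  assumes f: "set_integrable lborel {\<alpha>..\<beta>} f"
  shows "AE x in lborel. x \<in> {\<alpha><..<\<beta>} \<longrightarrow>
           ((\<lambda>u. LINT t:{\<alpha>..u}|lborel. f t) has_real_derivative f x) (at x)"
proof -
  have f': "set_integrable lborel {\<alpha>..\<beta>} (\<lambda>t. - f t)"
    using f by (simp add: set_integrable_def)
  show ?thesis
    using AE_average_excess_small[OF f] AE_average_excess_small[OF f']
  proof (eventually_elim, intro impI)
    fix x assume x: "x \<in> {\<alpha><..<\<beta>}"
    define P where "P = (\<lambda>f e d. \<forall>a b. a < b \<longrightarrow> x \<in> {a..b} \<longrightarrow> b - a < d \<longrightarrow>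
           {a..b} \<subseteq> {\<alpha>..\<beta>} \<and> (LINT t:{a..b}|lborel. f t) \<le> (f x + e) * (b - a))"
    assume A1: "x \<in> {\<alpha><..<\<beta>} \<longrightarrow> (\<forall>e>0. \<exists>d>0. \<forall>a b. a < b \<longrightarrow> x \<in> {a..b} \<longrightarrow> b - a < d \<longrightarrow>
           {a..b} \<subseteq> {\<alpha>..\<beta>} \<and> (LINT t:{a..b}|lborel. f t) \<le> (f x + e) * (b - a))"
      and A2: "x \<in> {\<alpha><..<\<beta>} \<longrightarrow> (\<forall>e>0. \<exists>d>0. \<forall>a b. a < b \<longrightarrow> x \<in> {a..b} \<longrightarrow> b - a < d \<longrightarrow>
           {a..b} \<subseteq> {\<alpha>..\<beta>} \<and> (LINT t:{a..b}|lborel. - f t) \<le> (- f x + e) * (b - a))"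
    let ?F = "\<lambda>u. LINT t:{\<alpha>..u}|lborel. f t"
    have inc: "\<bar>?F b - ?F a - f x * (b - a)\<bar> \<le> e * (b - a)"
      if "a < b" "x \<in> {a..b}" "b - a < d1" "b - a < d2" "P f e d1" "P (\<lambda>t. - f t) e d2" for a b e d1 d2
    proof -
      from that have s: "{a..b} \<subseteq> {\<alpha>..\<beta>}" and u1: "(LINT t:{a..b}|lborel. f t) \<le> (f x + e) * (b - a)"
        and u2: "(LINT t:{a..b}|lborel. - f t) \<le> (- f x + e) * (b - a)"
        unfolding P_def by blast+
      have ab: "\<alpha> \<le> a" "a < b" "b \<le> \<beta>" using s that(1) by auto
      have "?F b = ?F a + (LINT t:{a<..b}|lborel. f t)"
      proof -
        have "{\<alpha>..b} = {\<alpha>..a} \<union> {a<..b}" using ab by auto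
        then show ?thesis
          using ab by (simp only:) (intro set_integral_Un set_integrable_subset[OF f], auto)
      qed
      also have "(LINT t:{a<..b}|lborel. f t) = (LINT t:{a..b}|lborel. f t)"
        unfolding set_lebesgue_integral_def
        by (intro integral_discrete_difference[of "{a}"]) (auto simp: indicator_def)
      finally have "?F b - ?F a = (LINT t:{a..b}|lborel. f t)" by simp
      moreover have "(LINT t:{a..b}|lborel. - f t) = - (LINT t:{a..b}|lborel. f t)"
        by (simp add: set_lebesgue_integral_def)
      ultimately show ?thesis using u1 u2 by (auto simp: algebra_simps abs_le_iff)
    qed
    show "(?F has_real_derivative f x) (at x)"
      unfolding has_field_derivative_def has_derivative_at_alt
    proof (intro conjI allI impI)
      show "bounded_linear ((*) (f x))" by (rule bounded_linear_mult_right)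
      fix e :: real assume e: "0 < e"
      have "\<exists>d>0. P f e d"
        using A1[THEN mp, OF x, THEN spec, THEN mp, OF e] unfolding P_def .
      moreover have "\<exists>d>0. P (\<lambda>t. - f t) e d"
        using A2[THEN mp, OF x, THEN spec, THEN mp, OF e] unfolding P_def .
      ultimately obtain d1 d2 where d: "0 < d1" "0 < d2" "P f e d1" "P (\<lambda>t. - f t) e d2"
        by metis
      have "norm (?F y - ?F x - f x * (y - x)) \<le> e * norm (y - x)"
        if y: "norm (y - x) < min d1 d2" for y
      proof (cases y x rule: linorder_cases)
        case less
        then have "\<bar>?F x - ?F y - f x * (x - y)\<bar> \<le> e * (x - y)"
          using y d by (intro inc[of y x d1 d2]) auto
        then show ?thesis using less by (auto simp: algebra_simps abs_le_iff)
      next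
        case greater
        then have "\<bar>?F y - ?F x - f x * (y - x)\<bar> \<le> e * (y - x)"
          using y d by (intro inc[of x y d1 d2]) auto
        then show ?thesis using greater by simp
      qed simp
      then show "\<exists>d>0. \<forall>y. norm (y - x) < d \<longrightarrow> norm (?F y - ?F x - f x * (y - x)) \<le> e * norm (y - x)"
        using d by (intro exI[of _ "min d1 d2"]) auto
    qed
  qed
qed

section \<open>Sections of a copula\<close>

text \<open>The uniform second margin dominates the section of the copula at u, so the section is the
  integral of a density g. Differentiating this integral identifies the partial derivative of the
  copula with g almost everywhere; g is the Borel measurable version used from here on.\<close>

lemma copula_section_density:
  assumes C: "is_copula C" and u: "u \<in> {0..1}"
  obtains g :: "real \<Rightarrow> real" where
    "g \<in> borel_measurable borel" "integrable lborel g" "\<And>s. 0 \<le> g s"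
    "\<And>w. w \<in> {0..1} \<Longrightarrow> C u w = (LINT t:{0..w}|lborel. g t)"
    "AE s in lborel. s \<in> {0..1} \<longrightarrow> copula_dot C u s = g s"
proof -
  obtain \<nu> where \<nu>: "prob_space \<nu>" and sets_\<nu>[measurable_cong, simp]: "sets \<nu> = sets borel"
    and marg: "distr \<nu> borel snd = uniform_measure lborel {0..1::real}"
    and C_eq: "\<And>w. w \<in> {0..1} \<Longrightarrow> C u w = measure \<nu> ({..u} \<times> {..w})"
    using C u unfolding is_copula_def by blast
  interpret \<nu>: prob_space \<nu> by fact
  have space_\<nu>[simp]: "space \<nu> = UNIV"
    using sets_eq_imp_space_eq[OF sets_\<nu>] by simp
  have snd_m[measurable]: "snd \<in> \<nu> \<rightarrow>\<^sub>M (borel :: real measure)"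
    by (simp add: measurable_cong_sets[OF sets_\<nu> refl] borel_prod[symmetric])
  have rect[measurable]: "{..u} \<times> B \<in> sets \<nu>" if "B \<in> sets borel" for B :: "real set"
    using that by (simp add: borel_prod[symmetric])
  have [measurable]: "{..u} \<times> UNIV \<in> sets \<nu>"
    by (rule rect) simp
  define \<mu> where "\<mu> = distr (density \<nu> (indicator ({..u} \<times> UNIV))) borel snd"
  have sets_\<mu>[simp]: "sets \<mu> = sets borel" and space_\<mu>: "space \<mu> = UNIV"
    by (simp_all add: \<mu>_def)
  have \<mu>: "emeasure \<mu> B = emeasure \<nu> ({..u} \<times> B)" if B: "B \<in> sets borel" for B
  proof -
    have [measurable]: "snd -` B \<in> sets \<nu>"
      using measurable_sets[OF snd_m B] by simp
    then have sB: "(snd -` B :: (real \<times> real) set) \<in> sets borel" by simp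
    have "emeasure \<mu> B = (\<integral>\<^sup>+x. indicator ({..u} \<times> UNIV) x * indicator (snd -` B) x \<partial>\<nu>)"
      unfolding \<mu>_def using B sB by (simp add: emeasure_distr) (subst emeasure_density; simp)
    also have "\<dots> = (\<integral>\<^sup>+x. indicator ({..u} \<times> B) x \<partial>\<nu>)"
      by (intro nn_integral_cong) (auto simp: indicator_def)
    also have "\<dots> = emeasure \<nu> ({..u} \<times> B)"
      using rect[OF B] by (rule nn_integral_indicator)
    finally show ?thesis .
  qed
  have fin: "finite_measure \<mu>"
    by (rule finite_measureI) (simp add: space_\<mu> \<mu>)
  interpret \<mu>: finite_measure \<mu> by fact
  \<comment> \<open>The uniform margin makes the section absolutely continuous and confines it to the unit interval.\<close>
  have \<mu>_le: "emeasure \<mu> B \<le> emeasure lborel ({0..1} \<inter> B)" if B: "B \<in> sets borel" for B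
  proof -
    have "emeasure \<mu> B \<le> emeasure \<nu> (snd -` B \<inter> space \<nu>)"
      unfolding \<mu>[OF B] using measurable_sets[OF snd_m B] by (intro emeasure_mono) auto
    also have "\<dots> = emeasure (distr \<nu> borel snd) B"
      using B by (simp add: emeasure_distr)
    also have "\<dots> = emeasure lborel ({0..1} \<inter> B)"
      unfolding marg using B by (simp add: divide_ennreal_def)
    finally show ?thesis .
  qed
  have ac: "absolutely_continuous lborel \<mu>"
    unfolding absolutely_continuous_def
  proof
    fix B :: "real set" assume B: "B \<in> null_sets lborel"
    then have "emeasure lborel ({0..1} \<inter> B) = 0"
      by (metis Int_commute null_setsD1 null_set_Int2 sets_lborel atLeastAtMost_borel)
    with \<mu>_le[of B] B show "B \<in> null_sets \<mu>"
      by (intro null_setsI) auto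
  qed
  obtain g where g[measurable]: "g \<in> borel_measurable lborel"
    and RN: "AE x in lborel. RN_deriv lborel \<mu> x = ennreal (g x)" and g0: "\<And>x. 0 \<le> g x"
    by (rule sigma_finite_measure.real_RN_deriv[OF _ fin ac])
       (auto simp: sigma_finite_lborel)
  have dens: "density lborel (\<lambda>x. ennreal (g x)) = \<mu>"
  proof -
    have "density lborel (\<lambda>x. ennreal (g x)) = density lborel (RN_deriv lborel \<mu>)"
      using RN by (intro density_cong) auto
    then show ?thesis
      using sigma_finite_measure.density_RN_deriv[OF sigma_finite_lborel ac] by simp
  qed
  have gi: "integrable lborel g"
  proof (rule integrableI_nonneg)
    have "(\<integral>\<^sup>+x. ennreal (g x) \<partial>lborel) = emeasure \<mu> UNIV"
      unfolding dens[symmetric] by (subst emeasure_density) auto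
    then show "(\<integral>\<^sup>+x. ennreal (g x) \<partial>lborel) < \<infinity>"
      using \<mu>.emeasure_finite[of UNIV] by (simp add: less_top[symmetric])
  qed (use g0 in auto)
  have C_int: "C u w = (LINT t:{0..w}|lborel. g t)" if w: "w \<in> {0..1}" for w
  proof -
    have "emeasure \<mu> {..<0} = 0"
    proof -
      have "{0..1} \<inter> {..<0::real} = {}" by auto
      then show ?thesis using \<mu>_le[of "{..<0}"] by simp
    qed
    then have "emeasure \<mu> {..w} = emeasure \<mu> {0..w}"
      using emeasure_Un_null_set[of "{0..w}" \<mu> "{..<0}"] w
      by (auto simp: null_setsI ivl_disj_un Un_commute)
    also have "\<dots> = (\<integral>\<^sup>+x. ennreal (g x * indicator {0..w} x) \<partial>lborel)"
      unfolding dens[symmetric] 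
      by (subst emeasure_density) (auto simp: indicator_def intro!: nn_integral_cong)
    also have "\<dots> = ennreal (LINT t:{0..w}|lborel. g t)"
      using gi g0 unfolding set_lebesgue_integral_def
      by (subst nn_integral_eq_integral) (auto intro: integrable_real_mult_indicator simp: mult.commute)
    finally have "emeasure \<nu> ({..u} \<times> {..w}) = ennreal (LINT t:{0..w}|lborel. g t)"
      by (simp add: \<mu>)
    then show ?thesis
      using g0 unfolding C_eq[OF w] measure_def set_lebesgue_integral_def
      by (simp add: integral_nonneg_AE)
  qed
  have "set_integrable lborel {0..1} g"
    using gi by (auto simp: set_integrable_def mult.commute[of "indicator _ _"] intro: integrable_real_mult_indicator)
  from AE_has_derivative_indefinite_integral[OF this]
  have "AE s in lborel. s \<in> {0..1} \<longrightarrow> copula_dot C u s = g s"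
    using AE_lborel_singleton[of 0] AE_lborel_singleton[of 1]
  proof (eventually_elim, intro impI)
    fix s :: real
    assume "s \<in> {0<..<1} \<longrightarrow> ((\<lambda>v. LINT t:{0..v}|lborel. g t) has_real_derivative g s) (at s)"
      and "s \<noteq> 0" "s \<noteq> 1" "s \<in> {0..1}"
    then have s: "s \<in> {0<..<1}" and "((\<lambda>v. LINT t:{0..v}|lborel. g t) has_real_derivative g s) (at s)"
      by auto
    \<comment> \<open>The values of C are prescribed on the unit square only, so an open neighbourhood inside it is
      needed: this is why the end points 0 and 1 are excluded.\<close>
    then have "((\<lambda>v. C u v) has_real_derivative g s) (at s)"
      by (rule_tac has_field_derivative_transform_within_open[of _ _ _ "{0<..<1}"]) (auto simp: C_int)
    then show "copula_dot C u s = g s"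
      unfolding copula_dot_def by (rule DERIV_imp_deriv)
  qed
  with g gi g0 C_int show ?thesis
    by (intro that[of g]) auto
qed

text \<open>A derivative that exists only almost everywhere need not be Borel measurable, but completeness
  of Lebesgue measure makes it measurable once it agrees almost everywhere with a Borel function.\<close>

lemma set_integral_lebesgue_eq_lborel_AE:
  fixes f g :: "real \<Rightarrow> real"
  assumes A[measurable]: "A \<in> sets borel" and g[measurable]: "g \<in> borel_measurable borel"
    and ae: "AE s in lborel. s \<in> A \<longrightarrow> f s = g s"
  shows "(LINT s:A|lebesgue. f s) = (LINT s:A|lborel. g s)"
proof -
  have ae': "AE s in lebesgue. indicator A s *\<^sub>R g s = indicator A s *\<^sub>R f s"
  proof (rule AE_completion)
    show "AE s in lborel. indicator A s *\<^sub>R g s = indicator A s *\<^sub>R f s"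
      using ae by eventually_elim (auto simp: indicator_def)
  qed
  have g': "(\<lambda>s. indicator A s *\<^sub>R g s) \<in> borel_measurable lborel"
    by measurable
  have "(\<lambda>s. indicator A s *\<^sub>R f s) \<in> borel_measurable lebesgue"
    using measurable_completion[OF g'] ae' by (rule borel_measurable_AE)
  then have "(LINT s:A|lebesgue. f s) = (LINT s:A|lebesgue. g s)"
    unfolding set_lebesgue_integral_def
    using ae' measurable_completion[OF g'] by (intro integral_cong_AE) auto
  also have "\<dots> = (LINT s:A|lborel. g s)"
    unfolding set_lebesgue_integral_def using g' by (rule integral_completion)
  finally show ?thesis .
qed

section \<open>The probability integral transform\<close>

lemma (in finite_borel_measure) borel_measurable_cdf[measurable]: "cdf M \<in> borel_measurable borel"
  by (intro borel_measurable_mono monoI cdf_nondecreasing)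

text \<open>A continuous distribution function may have flat pieces, so z is taken as the right end of the
  level set at w; then the whole sublevel set is a half line whose probability can be read off.\<close>

lemma (in real_distribution) cdf_sublevel:
  assumes cont: "\<And>x. isCont (cdf M) x" and w: "0 < w" "w < 1"
  obtains z where "cdf M z = w" "{t. cdf M t \<le> w} = {..z}"
proof -
  obtain a where a: "cdf M a < w"
    using order_tendstoD(2)[OF cdf_lim_at_bot w(1)] by (auto simp: eventually_at_bot_linorder)
  obtain b where b: "w < cdf M b"
    using order_tendstoD(1)[OF cdf_lim_at_top_prob w(2)] by (auto simp: eventually_at_top_linorder)
  have "a \<le> b"
    using a b cdf_nondecreasing[of b a] by linarith
  then obtain y where y: "cdf M y = w"
    using IVT'[of "cdf M" a w b] a b cont by (auto intro: continuous_at_imp_continuous_on)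
  define S where "S = {t. cdf M t \<le> w}"
  have "closed S"
    unfolding S_def using cont by (intro closed_Collect_le continuous_at_imp_continuous_on) auto
  moreover have "bdd_above S"
  proof (rule bdd_aboveI)
    fix t assume "t \<in> S"
    then show "t \<le> b" using b cdf_nondecreasing[of b t] by (force simp: S_def)
  qed
  moreover have "y \<in> S" by (simp add: S_def y)
  ultimately have z: "Sup S \<in> S" and ub: "\<And>t. t \<in> S \<Longrightarrow> t \<le> Sup S"
    by (auto intro: closed_contains_Sup cSup_upper)
  have "S = {..Sup S}"
  proof (intro set_eqI iffI)
    fix t assume "t \<in> {..Sup S}"
    then have "cdf M t \<le> cdf M (Sup S)"
      by (intro cdf_nondecreasing) simp
    then show "t \<in> S"
      using z by (simp add: S_def)
  qed (use ub in auto)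
  moreover have "cdf M (Sup S) = w"
    using z ub[OF \<open>y \<in> S\<close>] cdf_nondecreasing[of y "Sup S"] y by (auto simp: S_def)
  ultimately show ?thesis
    using that[of "Sup S"] unfolding S_def by blast
qed

lemma (in real_distribution) measure_cdf_le:
  assumes cont: "\<And>x. isCont (cdf M) x" and w: "w \<in> {0..1}"
  shows "measure M {t. cdf M t \<le> w} = w"
proof -
  have *: "measure M {t. cdf M t \<le> v} = v" if "0 < v" "v < 1" for v
    using cdf_sublevel[OF cont that] by (metis cdf_def2)
  consider "w = 0" | "0 < w" "w < 1" | "w = 1" using w by force
  then show ?thesis
  proof cases
    case 1
    \<comment> \<open>The level 0 may not be attained, so it is approached from above.\<close>
    have "measure M {t. cdf M t \<le> 0} \<le> 0 + e" if "0 < e" for e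
    proof -
      have "measure M {t. cdf M t \<le> 0} \<le> measure M {t. cdf M t \<le> min e (1/2)}"
        using that by (intro finite_measure_mono) auto
      also have "\<dots> = min e (1/2)"
        using that by (intro *) auto
      finally show ?thesis by auto
    qed
    then have "measure M {t. cdf M t \<le> 0} \<le> 0"
      by (rule field_le_epsilon)
    then show ?thesis using 1 by (simp add: measure_le_0_iff)
  next
    case 3
    then show ?thesis using prob_space by (simp add: cdf_bounded_prob)
  qed (rule *)
qed

text \<open>The probability integral transform: by continuity, each sublevel set of the distribution
  function has probability equal to its level.\<close>

lemma (in real_distribution) distr_cdf:
  assumes cont: "\<And>x. isCont (cdf M) x"
  shows "distr M borel (cdf M) = uniform_measure lborel {0..1}"
proof (rule cdf_unique)
  show "real_distribution (distr M borel (cdf M))"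
    by (rule real_distribution_distr) simp
  show "real_distribution (uniform_measure lborel {0..1::real})"
    by (auto simp: real_distribution_def real_distribution_axioms_def intro!: prob_space_uniform_measure)
  show "cdf (distr M borel (cdf M)) = cdf (uniform_measure lborel {0..1})"
  proof
    fix w :: real
    have "cdf (distr M borel (cdf M)) w = measure M {t. cdf M t \<le> w}"
      by (simp add: cdf_def2 measure_distr vimage_def)
    also have "\<dots> = max 0 (min 1 w)"
    proof -
      consider "w < 0" | "w \<in> {0..1}" | "1 < w" by force
      then show ?thesis
      proof cases
        case 1
        then have "{t. cdf M t \<le> w} = {}"
          using cdf_nonneg by (auto simp: not_le intro: less_le_trans)
        then show ?thesis using 1 by simp
      next
        case 3
        then have "cdf M t \<le> w" for t
          using cdf_bounded_prob[of t] by linarith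
        then have "{t. cdf M t \<le> w} = space M"
          by simp
        then show ?thesis using 3 prob_space by simp
      qed (use measure_cdf_le[OF cont] in auto)
    qed
    also have "\<dots> = measure lborel ({0..1} \<inter> {..w})"
    proof -
      have "{0..1} \<inter> {..w} = {0..min 1 w}" by auto
      then show ?thesis by simp
    qed
    also have "\<dots> = cdf (uniform_measure lborel {0..1}) w"
      by (simp add: cdf_def2)
    finally show "cdf (distr M borel (cdf M)) w = cdf (uniform_measure lborel {0..1}) w" .
  qed
qed

text \<open>Although the distribution function need not be injective, passing to it loses only a null set:
  the events {F(t) \<le> F(z)} and {t \<le> z} are nested and both have probability F(z).\<close>

lemma (in real_distribution) AE_cdf_le_cdf_iff:
  assumes cont: "\<And>x. isCont (cdf M) x"
  shows "AE t in M. cdf M t \<le> cdf M z \<longleftrightarrow> t \<le> z"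
proof -
  have "measure M ({t. cdf M t \<le> cdf M z} - {..z}) = measure M {t. cdf M t \<le> cdf M z} - measure M {..z}"
    by (rule finite_measure_Diff) (auto intro: cdf_nondecreasing)
  also have "\<dots> = 0"
    using measure_cdf_le[OF cont, of "cdf M z"] by (simp add: cdf_nonneg cdf_bounded_prob cdf_def2[of M z])
  finally have "{t. cdf M t \<le> cdf M z} - {..z} \<in> null_sets M"
    by (intro null_setsI) (auto simp: emeasure_eq_measure)
  from AE_not_in[OF this] show ?thesis
    by eventually_elim (auto intro: cdf_nondecreasing)
qed

lemma (in real_distribution) distr_cdf_density:
  assumes cont: "\<And>x. isCont (cdf M) x"
  shows "distr M borel (cdf M) = density lborel (\<lambda>s. ennreal (indicator {0..1} s))"
  unfolding distr_cdf[OF cont] uniform_measure_def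
  by (intro density_cong) (auto split: split_indicator)

lemma (in real_distribution) integral_cdf:
  fixes h :: "real \<Rightarrow> real"
  assumes cont: "\<And>x. isCont (cdf M) x" and h[measurable]: "h \<in> borel_measurable borel"
  shows "(LINT t|M. h (cdf M t)) = (LINT s:{0..1}|lborel. h s)"
proof -
  have "(LINT t|M. h (cdf M t)) = (LINT s|distr M borel (cdf M). h s)"
    using integral_distr[of "cdf M" M borel h] borel_measurable_cdf h by simp
  also have "distr M borel (cdf M) = density lborel (\<lambda>s. ennreal (indicator {0..1} s))"
    by (rule distr_cdf_density[OF cont])
  also have "(LINT s|density lborel (\<lambda>s. ennreal (indicator {0..1} s)). h s) = (LINT s:{0..1}|lborel. h s)"
    by (subst integral_density) (auto simp: set_lebesgue_integral_def)
  finally show ?thesis .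
qed

lemma (in real_distribution) integrable_cdf:
  fixes h :: "real \<Rightarrow> real"
  assumes cont: "\<And>x. isCont (cdf M) x" and h: "set_integrable lborel {0..1} h"
    and hm[measurable]: "h \<in> borel_measurable borel"
  shows "integrable M (\<lambda>t. h (cdf M t))"
proof -
  have "distr M borel (cdf M) = density lborel (\<lambda>s. ennreal (indicator {0..1} s))"
    by (rule distr_cdf_density[OF cont])
  then have "integrable (distr M borel (cdf M)) h"
    using h by (simp add: integrable_density set_integrable_def)
  then show ?thesis
    using integrable_distr_eq[of "cdf M" M borel h] borel_measurable_cdf hm by simp
qed

section \<open>Conditional probabilities given a real random variable\<close>

text \<open>As a function of the Borel set B this is P(A \<inter> {Z \<in> B}); the conditional probability
  of A given Z = z is its Radon-Nikodym derivative with respect to the distribution of Z.\<close>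

definition event_distr :: "'a measure \<Rightarrow> ('a \<Rightarrow> real) \<Rightarrow> 'a set \<Rightarrow> real measure" where
  "event_distr M Z A = distr (density M (indicator A)) borel Z"

context prob_space
begin

lemma emeasure_event_distr:
  assumes Z[measurable]: "random_variable borel Z" and A[measurable]: "A \<in> events" and B: "B \<in> sets borel"
  shows "emeasure (event_distr M Z A) B = emeasure M {\<omega> \<in> A. Z \<omega> \<in> B}"
proof -
  have m[measurable]: "Z -` B \<inter> space M \<in> events"
    using B by measurable
  have "emeasure (event_distr M Z A) B = emeasure (density M (indicator A)) (Z -` B \<inter> space M)"
    unfolding event_distr_def using B by (subst emeasure_distr) auto
  also have "\<dots> = (\<integral>\<^sup>+\<omega>. indicator A \<omega> * indicator (Z -` B \<inter> space M) \<omega> \<partial>M)"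
    by (subst emeasure_density) auto
  also have "\<dots> = (\<integral>\<^sup>+\<omega>. indicator (A \<inter> (Z -` B \<inter> space M)) \<omega> \<partial>M)"
    by (intro nn_integral_cong) (auto simp: indicator_def)
  also have "\<dots> = emeasure M (A \<inter> (Z -` B \<inter> space M))"
    by (rule nn_integral_indicator) (intro sets.Int A m)
  also have "A \<inter> (Z -` B \<inter> space M) = {\<omega> \<in> A. Z \<omega> \<in> B}"
    using sets.sets_into_space[OF A] by auto
  finally show ?thesis .
qed

lemma cond_prob_at_measurable[measurable]:
  "cond_prob_at M Z A \<in> borel_measurable borel"
proof -
  have "(\<lambda>z. enn2real (RN_deriv (distr M borel Z) (event_distr M Z A) z)) \<in> borel_measurable (distr M borel Z)"
    by measurable
  then show ?thesis
    by (simp add: cond_prob_at_def[abs_def] event_distr_def)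
qed

lemma
  assumes Z[measurable]: "random_variable borel Z" and A[measurable]: "A \<in> events"
  shows integrable_cond_prob_at: "integrable (distr M borel Z) (cond_prob_at M Z A)"
    and set_integral_cond_prob_at: "B \<in> sets borel \<Longrightarrow>
          (LINT z:B|distr M borel Z. cond_prob_at M Z A z) = prob {\<omega> \<in> A. Z \<omega> \<in> B}"
proof -
  let ?Q = "distr M borel Z" and ?N = "event_distr M Z A"
  interpret Q: prob_space ?Q by (rule prob_space_distr) fact
  have ac: "absolutely_continuous ?Q ?N"
    unfolding absolutely_continuous_def
  proof
    fix B assume B: "B \<in> null_sets ?Q"
    then have [measurable]: "B \<in> sets borel" and 0: "emeasure M (Z -` B \<inter> space M) = 0"
      by (auto simp: null_sets_def emeasure_distr)
    have "emeasure ?N B \<le> emeasure M (Z -` B \<inter> space M)"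
      unfolding emeasure_event_distr[OF Z A \<open>B \<in> sets borel\<close>]
      using sets.sets_into_space[OF A] by (intro emeasure_mono) auto
    then show "B \<in> null_sets ?N"
      using 0 by (auto simp: null_sets_def event_distr_def)
  qed
  have sets: "sets ?N = sets ?Q"
    by (simp add: event_distr_def)
  have fin: "emeasure ?N B \<noteq> \<infinity>" if "B \<in> sets borel" for B
    using that by (simp add: emeasure_event_distr)
  have spN: "space ?N = UNIV" by (simp add: event_distr_def)
  have sN: "sigma_finite_measure ?N"
    by (intro finite_measure.axioms(1) finite_measureI) (simp only: spN fin[simplified] sets.top space_borel[symmetric], simp add: fin[simplified])
  have p: "cond_prob_at M Z A z = enn2real (RN_deriv ?Q ?N z)" for z
    by (simp add: cond_prob_at_def event_distr_def)
  have int1: "integrable ?N (indicator B :: real \<Rightarrow> real)" if "B \<in> sets borel" for B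
    using that fin[OF that] sets by (intro integrable_real_indicator) (auto simp: less_top[symmetric])
  have "integrable ?N (indicator UNIV :: real \<Rightarrow> real)"
    by (rule int1) simp
  then have "integrable ?N (\<lambda>z. 1 :: real)"
    by simp
  then show "integrable ?Q (cond_prob_at M Z A)"
    using Q.RN_deriv_integrable[OF sN ac sets, of "\<lambda>z. 1"] by (simp add: p[abs_def])
  assume B: "B \<in> sets borel"
  have "(LINT z:B|?Q. cond_prob_at M Z A z) = (LINT z|?N. indicator B z)"
    using B by (subst Q.RN_deriv_integral[OF sN ac sets])
      (auto simp: p set_lebesgue_integral_def mult.commute)
  also have "\<dots> = measure ?N B"
    using B spN by simp
  also have "\<dots> = prob {\<omega> \<in> A. Z \<omega> \<in> B}"
    unfolding measure_def using B by (simp add: emeasure_event_distr)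
  finally show "(LINT z:B|?Q. cond_prob_at M Z A z) = prob {\<omega> \<in> A. Z \<omega> \<in> B}" .
qed

text \<open>Conditional probabilities are bounded by 1 only almost everywhere, because they are arbitrary
  versions of a derivative; the bound comes from P(A \<inter> {Z \<in> B}) \<le> P(Z \<in> B) for all B.\<close>

lemma AE_cond_prob_at_le_1:
  assumes Z[measurable]: "random_variable borel Z" and A[measurable]: "A \<in> events"
  shows "AE z in distr M borel Z. cond_prob_at M Z A z \<le> 1"
proof -
  let ?Q = "distr M borel Z" and ?p = "cond_prob_at M Z A"
  interpret Q: prob_space ?Q by (rule prob_space_distr) fact
  note ip = integrable_cond_prob_at[OF Z A]
  have "AE z in ?Q. 0 \<le> 1 - ?p z"
  proof (rule Q.density_nonneg)
    show "integrable ?Q (\<lambda>z. 1 - ?p z)"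
      using ip by simp
    fix B assume "B \<in> sets ?Q"
    then have B[measurable]: "B \<in> sets borel" by simp
    have i1: "set_integrable ?Q B (\<lambda>z. 1 :: real)" and i2: "set_integrable ?Q B ?p"
      using integrable_mult_indicator[of B ?Q "\<lambda>z. 1 :: real"] integrable_mult_indicator[OF _ ip, of B] B
      by (auto simp: set_integrable_def)
    have "(LINT z:B|?Q. 1 - ?p z) = (LINT z:B|?Q. 1) - (LINT z:B|?Q. ?p z)"
      using i1 i2 by (rule set_integral_diff)
    also have "(LINT z:B|?Q. 1) = prob (Z -` B \<inter> space M)"
      by (simp add: set_lebesgue_integral_def measure_distr)
    also have "(LINT z:B|?Q. ?p z) = prob {\<omega> \<in> A. Z \<omega> \<in> B}"
      by (rule set_integral_cond_prob_at[OF Z A B])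
    finally have "(LINT z:B|?Q. 1 - ?p z) = prob (Z -` B \<inter> space M) - prob {\<omega> \<in> A. Z \<omega> \<in> B}" .
    moreover have "prob {\<omega> \<in> A. Z \<omega> \<in> B} \<le> prob (Z -` B \<inter> space M)"
      using sets.sets_into_space[OF A] by (intro finite_measure_mono) auto
    ultimately show "0 \<le> (LINT z:B|?Q. 1 - ?p z)" by simp
  qed
  then show ?thesis by eventually_elim simp
qed

lemma cond_prob_at_nonneg: "0 \<le> cond_prob_at M Z A z"
  by (simp add: cond_prob_at_def)

lemma integral_cond_prob_at:
  assumes Z[measurable]: "random_variable borel Z" and A[measurable]: "A \<in> events"
  shows "(LINT z|distr M borel Z. cond_prob_at M Z A z) = prob A"
  using set_integral_cond_prob_at[OF Z A, of UNIV] by (simp add: set_lebesgue_integral_def)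

text \<open>Half lines determine a finite Borel measure, so a candidate for the conditional probability
  needs to be tested against the events Z \<le> z only.\<close>

lemma cond_prob_at_unique:
  fixes h :: "real \<Rightarrow> real"
  assumes Z[measurable]: "random_variable borel Z" and A[measurable]: "A \<in> events"
    and h: "integrable (distr M borel Z) h" and h0: "\<And>z. 0 \<le> h z"
    and eq: "\<And>z. (LINT t:{..z}|distr M borel Z. h t) = prob {\<omega> \<in> A. Z \<omega> \<le> z}"
  shows "AE z in distr M borel Z. cond_prob_at M Z A z = h z"
proof -
  let ?Q = "distr M borel Z" and ?p = "cond_prob_at M Z A"
  note ip = integrable_cond_prob_at[OF Z A]
  have dens: "finite_borel_measure (density ?Q (\<lambda>z. ennreal (f z)))"
    "B \<in> sets borel \<Longrightarrow> measure (density ?Q (\<lambda>z. ennreal (f z))) B = (LINT t:B|?Q. f t)"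
    if f: "integrable ?Q f" "\<And>z. 0 \<le> f z" for f :: "real \<Rightarrow> real" and B
  proof -
    have fm[measurable]: "f \<in> borel_measurable borel"
      using borel_measurable_integrable[OF f(1)] by simp
    have *: "emeasure (density ?Q (\<lambda>z. ennreal (f z))) B = ennreal (LINT t:B|?Q. f t)"
      if B: "B \<in> sets borel" for B
    proof -
      have "emeasure (density ?Q (\<lambda>z. ennreal (f z))) B = (\<integral>\<^sup>+z. ennreal (indicator B z *\<^sub>R f z) \<partial>?Q)"
        using B by (subst emeasure_density) (auto simp: indicator_def intro!: nn_integral_cong)
      also have "\<dots> = ennreal (LINT t:B|?Q. f t)"
        unfolding set_lebesgue_integral_def using B f
        by (intro nn_integral_eq_integral integrable_mult_indicator) auto
      finally show ?thesis .
    qed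
    show "finite_borel_measure (density ?Q (\<lambda>z. ennreal (f z)))"
      by (auto simp: finite_borel_measure_def finite_borel_measure_axioms_def * intro!: finite_measureI)
    assume B: "B \<in> sets borel"
    have "0 \<le> (LINT t:B|?Q. f t)"
      using f(2) unfolding set_lebesgue_integral_def by (intro integral_nonneg_AE) auto
    then show "measure (density ?Q (\<lambda>z. ennreal (f z))) B = (LINT t:B|?Q. f t)"
      by (simp add: measure_def *[OF B])
  qed
  note dp = dens[OF ip cond_prob_at_nonneg] and dh = dens[OF h h0]
  have "density ?Q (\<lambda>z. ennreal (?p z)) = density ?Q (\<lambda>z. ennreal (h z))"
  proof (rule cdf_unique'[OF dp(1) dh(1)], rule ext)
    fix z
    show "cdf (density ?Q (\<lambda>z. ennreal (?p z))) z = cdf (density ?Q (\<lambda>z. ennreal (h z))) z"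
      unfolding cdf_def using set_integral_cond_prob_at[OF Z A, of "{..z}"] eq[of z]
      by (subst dp(2), simp, subst dh(2)) auto
  qed
  then have "(LINT t:B|?Q. ?p t) = (LINT t:B|?Q. h t)" if "B \<in> sets ?Q" for B
    using dp(2)[of B] dh(2)[of B] that by simp
  with ip h show ?thesis
    by (intro density_unique_real) auto
qed

end

section \<open>Conditional independence for subfamilies and complements\<close>

lemma one_minus_prod_le_sum:
  fixes b :: "'i \<Rightarrow> real"
  assumes "finite T" "\<And>i. i \<in> T \<Longrightarrow> 0 \<le> b i \<and> b i \<le> 1"
  shows "1 - (\<Prod>i\<in>T. b i) \<le> (\<Sum>i\<in>T. 1 - b i)"
  using assms
proof (induction T rule: finite_induct)
  case (insert t T)
  have "b t * (1 - (\<Prod>i\<in>T. b i)) \<le> 1 * (1 - (\<Prod>i\<in>T. b i))"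
    using insert.prems by (intro mult_right_mono) (auto intro: prod_le_1)
  then have "1 - b t * (\<Prod>i\<in>T. b i) \<le> (1 - b t) + (1 - (\<Prod>i\<in>T. b i))"
    by (simp add: algebra_simps)
  then show ?case
    using insert by (simp add: order_trans)
qed simp

context prob_space
begin

lemma AE_cond_prob_at_bounds:
  assumes Z: "random_variable borel Z" and fin: "finite I" and A: "\<And>i. i \<in> I \<Longrightarrow> A i \<in> events"
  shows "AE z in distr M borel Z. \<forall>i\<in>I. 0 \<le> cond_prob_at M Z (A i) z \<and> cond_prob_at M Z (A i) z \<le> 1"
proof (rule AE_finite_allI[OF fin])
  fix i assume "i \<in> I"
  from AE_cond_prob_at_le_1[OF Z A[OF this]]
  show "AE z in distr M borel Z. 0 \<le> cond_prob_at M Z (A i) z \<and> cond_prob_at M Z (A i) z \<le> 1"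
    by eventually_elim (simp add: cond_prob_at_nonneg)
qed

lemma integrable_prod_cond_prob_at:
  assumes Z: "random_variable borel Z" and fin: "finite S" "finite T"
    and A: "\<And>i. i \<in> S \<union> T \<Longrightarrow> A i \<in> events"
  shows "integrable (distr M borel Z)
           (\<lambda>z. (\<Prod>i\<in>S. cond_prob_at M Z (A i) z) * (\<Prod>i\<in>T. 1 - cond_prob_at M Z (A i) z))"
proof -
  interpret Q: prob_space "distr M borel Z" by (rule prob_space_distr) fact
  show ?thesis
  proof (rule Q.integrable_const_bound[where B = 1])
    show "AE z in distr M borel Z.
        norm ((\<Prod>i\<in>S. cond_prob_at M Z (A i) z) * (\<Prod>i\<in>T. 1 - cond_prob_at M Z (A i) z)) \<le> 1"
    proof -
      have "AE z in distr M borel Z. \<forall>i\<in>S \<union> T. 0 \<le> cond_prob_at M Z (A i) z \<and> cond_prob_at M Z (A i) z \<le> 1"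
        using fin by (intro AE_cond_prob_at_bounds[OF Z] A) auto
      then show ?thesis
      proof eventually_elim
        case (elim z)
        then have "0 \<le> (\<Prod>i\<in>S. cond_prob_at M Z (A i) z)" "(\<Prod>i\<in>S. cond_prob_at M Z (A i) z) \<le> 1"
          "0 \<le> (\<Prod>i\<in>T. 1 - cond_prob_at M Z (A i) z)" "(\<Prod>i\<in>T. 1 - cond_prob_at M Z (A i) z) \<le> 1"
          by (auto intro!: prod_nonneg prod_le_1)
        then show ?case by (simp add: abs_mult mult_le_one)
      qed
    qed
    show "(\<lambda>z. (\<Prod>i\<in>S. cond_prob_at M Z (A i) z) * (\<Prod>i\<in>T. 1 - cond_prob_at M Z (A i) z))
            \<in> borel_measurable (distr M borel Z)"
      by simp
  qed
qed

text \<open>Conditional independence speaks about all n variables at once. A factor is removed by sending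
  its threshold to infinity: the conditional probabilities then tend to 1 in the mean, and since
  all factors lie in [0,1] the error of the product is at most the sum of the missing masses
  P(X_i > k).\<close>

lemma cond_indep_given_subset:
  assumes Z: "random_variable borel Z"
    and X: "\<And>i. i \<in> {1..n} \<Longrightarrow> random_variable borel (X i)"
    and ci: "cond_indep_given M n X Z" and S: "S \<subseteq> {1..n}"
  shows "prob {\<omega> \<in> space M. \<forall>i\<in>S. X i \<omega> \<le> y i} =
    (LINT z|distr M borel Z. (\<Prod>i\<in>S. cond_prob_at M Z {\<omega> \<in> space M. X i \<omega> \<le> y i} z))"
proof -
  let ?Q = "distr M borel Z"
  interpret Q: prob_space ?Q by (rule prob_space_distr) fact
  define T where "T = {1..n} - S"
  have fin: "finite S" "finite T" and dis: "S \<inter> T = {}" and un: "S \<union> T = {1..n}"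
    using S by (auto simp: T_def intro: finite_subset)
  define w where "w = (\<lambda>(k::nat) i. if i \<in> S then y i else real k)"
  define A where "A = (\<lambda>i c. {\<omega> \<in> space M. X i \<omega> \<le> c})"
  have A: "A i c \<in> events" if "i \<in> {1..n}" for i c
  proof -
    have [measurable]: "X i \<in> borel_measurable M" using X that .
    show ?thesis unfolding A_def by measurable
  qed
  define E where "E = (\<lambda>k. {\<omega> \<in> space M. \<forall>i\<in>{1..n}. X i \<omega> \<le> w k i})"
  have E: "E k \<in> events" for k
    unfolding E_def using A by (intro sets.sets_Collect_finite_All) (auto simp: A_def)
  define p where "p = (\<lambda>i c. cond_prob_at M Z (A i c))"
  have prob_E: "prob (E k) = (LINT z|?Q. (\<Prod>i\<in>S. p i (y i) z) * (\<Prod>i\<in>T. p i (real k) z))" for k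
  proof -
    have "prob (E k) = (LINT z|?Q. cond_prob_at M Z (E k) z)"
      by (rule integral_cond_prob_at[OF Z E, symmetric])
    also have "\<dots> = (LINT z|?Q. (\<Prod>i\<in>S. p i (y i) z) * (\<Prod>i\<in>T. p i (real k) z))"
    proof (rule integral_cong_AE)
      have "AE z in ?Q. cond_prob_at M Z (E k) z = (\<Prod>i=1..n. p i (w k i) z)"
        using ci unfolding cond_indep_given_def E_def p_def A_def by blast
      then show "AE z in ?Q. cond_prob_at M Z (E k) z = (\<Prod>i\<in>S. p i (y i) z) * (\<Prod>i\<in>T. p i (real k) z)"
      proof eventually_elim
        case (elim z)
        also have "(\<Prod>i=1..n. p i (w k i) z) = (\<Prod>i\<in>S. p i (w k i) z) * (\<Prod>i\<in>T. p i (w k i) z)"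
          unfolding un[symmetric] using fin dis by (rule prod.union_disjoint)
        also have "(\<Prod>i\<in>S. p i (w k i) z) = (\<Prod>i\<in>S. p i (y i) z)"
          by (simp add: w_def)
        also have "(\<Prod>i\<in>T. p i (w k i) z) = (\<Prod>i\<in>T. p i (real k) z)"
          using dis by (intro prod.cong) (auto simp: w_def)
        finally show ?case .
      qed
    qed (simp_all add: p_def)
    finally show ?thesis .
  qed
  let ?I = "LINT z|?Q. (\<Prod>i\<in>S. p i (y i) z)"
  have int_a: "integrable ?Q (\<lambda>z. \<Prod>i\<in>S. p i (y i) z)"
  proof -
    have "integrable ?Q (\<lambda>z. (\<Prod>i\<in>S. p i (y i) z) * (\<Prod>i\<in>{}. 1 - p i (y i) z))"
      unfolding p_def using fin un by (intro integrable_prod_cond_prob_at[OF Z] A) auto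
    then show ?thesis by simp
  qed
  have bound: "\<bar>prob (E k) - ?I\<bar> \<le> (\<Sum>i\<in>T. 1 - prob (A i (real k)))" for k
  proof -
    have int_ab: "integrable ?Q (\<lambda>z. (\<Prod>i\<in>S. p i (y i) z) * (\<Prod>i\<in>T. p i (real k) z))"
    proof -
      have "integrable ?Q (\<lambda>z. (\<Prod>i\<in>S \<union> T. p i (w k i) z) * (\<Prod>i\<in>{}. 1 - p i (w k i) z))"
        unfolding p_def using fin un by (intro integrable_prod_cond_prob_at[OF Z] A) auto
      then have "integrable ?Q (\<lambda>z. \<Prod>i\<in>S \<union> T. p i (w k i) z)"
        by simp
      also have "(\<lambda>z. \<Prod>i\<in>S \<union> T. p i (w k i) z) = (\<lambda>z. (\<Prod>i\<in>S. p i (y i) z) * (\<Prod>i\<in>T. p i (real k) z))"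
      proof
        fix z
        have "(\<Prod>i\<in>T. p i (w k i) z) = (\<Prod>i\<in>T. p i (real k) z)"
          using dis by (intro prod.cong) (auto simp: w_def)
        then show "(\<Prod>i\<in>S \<union> T. p i (w k i) z) = (\<Prod>i\<in>S. p i (y i) z) * (\<Prod>i\<in>T. p i (real k) z)"
          using fin dis by (subst prod.union_disjoint) (auto simp: w_def)
      qed
      finally show ?thesis .
    qed
    have int_p: "integrable ?Q (p i (real k))" if "i \<in> T" for i
      unfolding p_def using that un by (intro integrable_cond_prob_at[OF Z A]) auto
    have AE01: "AE z in ?Q. (\<forall>i\<in>S. 0 \<le> p i (y i) z \<and> p i (y i) z \<le> 1) \<and>
                            (\<forall>i\<in>T. 0 \<le> p i (real k) z \<and> p i (real k) z \<le> 1)"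
    proof -
      have "AE z in ?Q. \<forall>i\<in>S. 0 \<le> p i (y i) z \<and> p i (y i) z \<le> 1"
        "AE z in ?Q. \<forall>i\<in>T. 0 \<le> p i (real k) z \<and> p i (real k) z \<le> 1"
        unfolding p_def using un by (intro AE_cond_prob_at_bounds[OF Z] fin A; auto)+
      then show ?thesis by eventually_elim simp
    qed
    have le: "AE z in ?Q. (\<Prod>i\<in>S. p i (y i) z) * (\<Prod>i\<in>T. p i (real k) z) \<le> (\<Prod>i\<in>S. p i (y i) z)"
      using AE01 by eventually_elim (auto intro!: mult_right_le_one_le prod_nonneg prod_le_1)
    have ge: "AE z in ?Q. (\<Prod>i\<in>S. p i (y i) z) - (\<Prod>i\<in>S. p i (y i) z) * (\<Prod>i\<in>T. p i (real k) z)
                \<le> (\<Sum>i\<in>T. 1 - p i (real k) z)"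
      using AE01
    proof eventually_elim
      case (elim z)
      have "(\<Prod>i\<in>S. p i (y i) z) * (1 - (\<Prod>i\<in>T. p i (real k) z)) \<le> 1 * (1 - (\<Prod>i\<in>T. p i (real k) z))"
        using elim by (intro mult_right_mono) (auto intro!: prod_le_1)
      also have "\<dots> \<le> (\<Sum>i\<in>T. 1 - p i (real k) z)"
        using one_minus_prod_le_sum[OF fin(2), of "\<lambda>i. p i (real k) z"] elim by simp
      finally show ?case by (simp add: algebra_simps)
    qed
    have "?I - prob (E k) = (LINT z|?Q. (\<Prod>i\<in>S. p i (y i) z) - (\<Prod>i\<in>S. p i (y i) z) * (\<Prod>i\<in>T. p i (real k) z))"
      unfolding prob_E by (rule Bochner_Integration.integral_diff[OF int_a int_ab, symmetric])
    also have "\<dots> \<le> (LINT z|?Q. (\<Sum>i\<in>T. 1 - p i (real k) z))"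
      using ge int_p by (intro integral_mono_AE Bochner_Integration.integrable_diff int_a int_ab
          Bochner_Integration.integrable_sum) auto
    also have "\<dots> = (\<Sum>i\<in>T. LINT z|?Q. 1 - p i (real k) z)"
      using int_p by (intro Bochner_Integration.integral_sum) auto
    also have "\<dots> = (\<Sum>i\<in>T. 1 - prob (A i (real k)))"
    proof (rule sum.cong[OF refl])
      fix i assume i: "i \<in> T"
      have "(LINT z|?Q. p i (real k) z) = prob (A i (real k))"
        unfolding p_def using i un by (intro integral_cond_prob_at[OF Z A]) auto
      then show "(LINT z|?Q. 1 - p i (real k) z) = 1 - prob (A i (real k))"
        using int_p[OF i] Q.prob_space by simp
    qed
    finally have "?I - prob (E k) \<le> (\<Sum>i\<in>T. 1 - prob (A i (real k)))" .
    moreover have "prob (E k) \<le> ?I"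
      unfolding prob_E using le by (intro integral_mono_AE int_ab int_a)
    moreover have "0 \<le> (\<Sum>i\<in>T. 1 - prob (A i (real k)))"
      by (intro sum_nonneg) simp
    ultimately show ?thesis by (simp add: abs_le_iff)
  qed
  have "(\<lambda>k. prob (A i (real k))) \<longlonglongrightarrow> 1" if i: "i \<in> T" for i
  proof -
    have Xi: "random_variable borel (X i)"
      using i un by (intro X) auto
    interpret D: real_distribution "distr M borel (X i)"
      using Xi by (rule real_distribution_distr)
    have "cdf (distr M borel (X i)) c = prob (A i c)" for c
      unfolding cdf_def using Xi
      by (subst measure_distr) (auto simp: A_def intro!: arg_cong[where f = prob])
    then show ?thesis
      using D.cdf_lim_infty_prob by simp
  qed
  then have "(\<lambda>k. \<Sum>i\<in>T. 1 - prob (A i (real k))) \<longlonglongrightarrow> (\<Sum>i\<in>T. 1 - 1)"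
    by (intro tendsto_sum tendsto_diff tendsto_const)
  then have lim0: "(\<lambda>k. \<Sum>i\<in>T. 1 - prob (A i (real k))) \<longlonglongrightarrow> 0"
    by simp
  have "(\<lambda>k. prob (E k) - ?I) \<longlonglongrightarrow> 0"
    by (rule Lim_null_comparison[OF _ lim0]) (use bound in auto)
  then have lim1: "(\<lambda>k. prob (E k)) \<longlonglongrightarrow> ?I"
    by (simp add: LIM_zero_iff)
  have "incseq E"
    unfolding E_def w_def incseq_def by (auto intro: order_trans)
  then have "(\<lambda>k. prob (E k)) \<longlonglongrightarrow> prob (\<Union>k. E k)"
    using E by (intro finite_Lim_measure_incseq) auto
  also have "(\<Union>k. E k) = {\<omega> \<in> space M. \<forall>i\<in>S. X i \<omega> \<le> y i}"
  proof (intro set_eqI iffI)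
    fix \<omega> assume "\<omega> \<in> (\<Union>k. E k)"
    then show "\<omega> \<in> {\<omega> \<in> space M. \<forall>i\<in>S. X i \<omega> \<le> y i}"
      using S by (fastforce simp: E_def w_def)
  next
    fix \<omega> assume \<omega>: "\<omega> \<in> {\<omega> \<in> space M. \<forall>i\<in>S. X i \<omega> \<le> y i}"
    obtain k where k: "(\<Sum>i\<in>T. \<bar>X i \<omega>\<bar>) \<le> real k"
      using real_arch_simple by blast
    have "X i \<omega> \<le> real k" if "i \<in> T" for i
      using member_le_sum[OF that, of "\<lambda>i. \<bar>X i \<omega>\<bar>"] fin k by simp
    then have "\<omega> \<in> E k"
      using \<omega> un by (auto simp: E_def w_def)
    then show "\<omega> \<in> (\<Union>k. E k)" by blast
  qed
  finally show ?thesis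
    using LIMSEQ_unique lim1 unfolding p_def A_def by blast
qed

text \<open>Complements enter one at a time through P(E \<inter> A^c) = P(E) - P(E \<inter> A), which on the side of the
  integrands is the identity a (1 - p) = a - a p. The set S must vary in the induction, since A
  joins it.\<close>

lemma cond_indep_given_complements:
  assumes Z: "random_variable borel Z"
    and X: "\<And>i. i \<in> {1..n} \<Longrightarrow> random_variable borel (X i)"
    and ci: "cond_indep_given M n X Z"
    and T: "finite T" "T \<subseteq> {1..n}" and S: "S \<subseteq> {1..n}" "S \<inter> T = {}"
  shows "prob {\<omega> \<in> space M. (\<forall>i\<in>S. X i \<omega> \<le> y i) \<and> (\<forall>i\<in>T. \<not> X i \<omega> \<le> y i)} =
    (LINT z|distr M borel Z.
       (\<Prod>i\<in>S. cond_prob_at M Z {\<omega> \<in> space M. X i \<omega> \<le> y i} z) *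
       (\<Prod>i\<in>T. 1 - cond_prob_at M Z {\<omega> \<in> space M. X i \<omega> \<le> y i} z))"
  using T S
proof (induction T arbitrary: S rule: finite_induct)
  case empty
  then show ?case using cond_indep_given_subset[OF Z X ci, of S y] by simp
next
  case (insert t T)
  let ?Q = "distr M borel Z"
  define A where "A = (\<lambda>i. {\<omega> \<in> space M. X i \<omega> \<le> y i})"
  have A: "A i \<in> events" if "i \<in> {1..n}" for i
  proof -
    have [measurable]: "X i \<in> borel_measurable M" using X that .
    show ?thesis unfolding A_def by measurable
  qed
  define p where "p = (\<lambda>i. cond_prob_at M Z (A i))"
  define Ev where "Ev = (\<lambda>S T. {\<omega> \<in> space M. (\<forall>i\<in>S. X i \<omega> \<le> y i) \<and> (\<forall>i\<in>T. \<not> X i \<omega> \<le> y i)})"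
  have finS: "finite S" using insert.prems by (auto intro: finite_subset)
  have Ev: "Ev S' T' \<in> events" if "S' \<subseteq> {1..n}" "T' \<subseteq> {1..n}" for S' T'
  proof -
    have "finite S'" "finite T'" using that by (auto intro: finite_subset)
    then show ?thesis
      unfolding Ev_def using A that
      by (intro sets.sets_Collect_conj sets.sets_Collect_finite_All sets.sets_Collect_neg) (auto simp: A_def)
  qed
  define J where "J = (\<lambda>S T z. (\<Prod>i\<in>S. p i z) * (\<Prod>i\<in>T. 1 - p i z))"
  have int_J: "integrable ?Q (J S' T)" if "S' \<subseteq> {1..n}" for S'
    unfolding J_def p_def using that insert A
    by (intro integrable_prod_cond_prob_at[OF Z]) (auto intro: finite_subset)
  have IH: "prob (Ev S' T) = (LINT z|?Q. J S' T z)" if "S' \<subseteq> {1..n}" "S' \<inter> T = {}" for S'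
    using insert.IH[of S'] insert.prems that unfolding Ev_def J_def p_def A_def by simp
  have t: "insert t S \<subseteq> {1..n}" "insert t S \<inter> T = {}" "t \<notin> S"
    using insert by auto
  have "Ev S (insert t T) = Ev S T - Ev (insert t S) T"
    by (auto simp: Ev_def)
  moreover have "prob (Ev S T - Ev (insert t S) T) = prob (Ev S T) - prob (Ev (insert t S) T)"
    using insert.prems t by (intro finite_measure_Diff Ev) (auto simp: Ev_def)
  ultimately have "prob (Ev S (insert t T)) = (LINT z|?Q. J S T z) - (LINT z|?Q. J (insert t S) T z)"
    using IH[of S] IH[OF t(1,2)] insert.prems by auto
  also have "\<dots> = (LINT z|?Q. J S T z - J (insert t S) T z)"
    using int_J[of S] int_J[OF t(1)] insert.prems by simp
  also have "\<dots> = (LINT z|?Q. J S (insert t T) z)"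
    using insert.hyps finS t(3) by (intro Bochner_Integration.integral_cong) (auto simp: J_def algebra_simps)
  finally show ?case
    unfolding Ev_def J_def p_def A_def .
qed

end

section \<open>Permutations, subsets and order statistics\<close>

text \<open>Composing with a permutation that carries T to T' embeds the permutations sending the first k
  indices onto T into those sending them onto T'. So the fibres over all k-subsets have equal size,
  namely n! divided by the binomial coefficient.\<close>

lemma card_permutes_image_eq:
  assumes "S \<subseteq> {1..n}"
  shows "card {j. j permutes {1..n} \<and> j ` {1..card S} = S} = fact (card S) * fact (n - card S)"
proof -
  let ?k = "card S"
  let ?fib = "\<lambda>T. {j. j permutes {1..n} \<and> j ` {1..?k} = T}"
  let ?Sub = "{T. T \<subseteq> {1..n} \<and> card T = ?k}"
  have fin: "finite {j. j permutes {1..n::nat}}"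
    by (rule finite_permutations) simp
  have kn: "?k \<le> n"
    using card_mono[OF _ assms] by simp
  have le: "card (?fib T) \<le> card (?fib T')" if T: "T \<in> ?Sub" and T': "T' \<in> ?Sub" for T T'
  proof -
    have finT: "finite T" "finite T'" using T T' by (auto intro: finite_subset)
    obtain f where f: "bij_betw f T T'"
      using finite_same_card_bij[OF finT] T T' by auto
    have "card ({1..n} - T) = card ({1..n} - T')"
      using T T' finT by (simp add: card_Diff_subset)
    then obtain g where g: "bij_betw g ({1..n} - T) ({1..n} - T')"
      using finite_same_card_bij[of "{1..n} - T" "{1..n} - T'"] by auto
    define p where "p = (\<lambda>x. if x \<in> T then f x else if x \<in> {1..n} then g x else x)"
    have "bij_betw p T T'"
      using f by (rule bij_betw_cong[THEN iffD1, rotated]) (simp add: p_def)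
    moreover have "bij_betw p ({1..n} - T) ({1..n} - T')"
      using g by (rule bij_betw_cong[THEN iffD1, rotated]) (simp add: p_def)
    ultimately have "bij_betw p (T \<union> ({1..n} - T)) (T' \<union> ({1..n} - T'))"
      by (rule bij_betw_combine) auto
    moreover have "T \<union> ({1..n} - T) = {1..n}" "T' \<union> ({1..n} - T') = {1..n}"
      using T T' by auto
    ultimately have bp: "bij_betw p {1..n} {1..n}" by simp
    have p: "p permutes {1..n}"
      using T by (intro bij_imp_permutes[OF bp]) (auto simp: p_def)
    have pT: "p ` T = T'"
      using \<open>bij_betw p T T'\<close> by (simp add: bij_betw_def)
    have "inj_on (\<lambda>j. p \<circ> j) (?fib T)"
    proof (rule inj_onI)
      fix j j' assume "p \<circ> j = p \<circ> j'"
      then have "p (j x) = p (j' x)" for x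
        by (metis comp_apply)
      then show "j = j'"
        using permutes_inj[OF p] by (intro ext) (simp add: inj_eq)
    qed
    moreover have "(\<lambda>j. p \<circ> j) ` ?fib T \<subseteq> ?fib T'"
      using p pT by (auto simp: permutes_compose image_comp[symmetric])
    moreover have "finite (?fib T')"
      by (rule finite_subset[OF _ fin]) auto
    ultimately show ?thesis
      by (rule card_inj_on_le)
  qed
  have eq: "card (?fib T) = card (?fib S)" if "T \<in> ?Sub" for T
    using le[OF that, of S] le[of S T] that assms by force
  have "card {j. j permutes {1..n}} = card (\<Union>T\<in>?Sub. ?fib T)"
  proof (rule arg_cong[where f = card], intro set_eqI iffI)
    fix j assume "j \<in> {j. j permutes {1..n}}"
    then have j: "j permutes {1..n}" by simp
    have "j ` {1..?k} \<subseteq> {1..n}"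
      using permutes_image[OF j] kn by (metis atLeastatMost_subset_iff image_mono order_refl)
    moreover have "card (j ` {1..?k}) = ?k"
      using permutes_inj[OF j] by (subst card_image) (auto intro: inj_on_subset)
    ultimately show "j \<in> (\<Union>T\<in>?Sub. ?fib T)" using j by auto
  qed auto
  also have "\<dots> = (\<Sum>T\<in>?Sub. card (?fib T))"
    by (rule card_UN_disjoint) (auto intro: finite_subset[OF _ fin])
  also have "\<dots> = (\<Sum>T\<in>?Sub. card (?fib S))"
    by (rule sum.cong) (use eq in auto)
  also have "\<dots> = (n choose ?k) * card (?fib S)"
    by (simp add: n_subsets)
  finally have "fact n = (n choose ?k) * card (?fib S)"
    by (simp add: card_permutations)
  also have "fact n = (n choose ?k) * (fact ?k * fact (n - ?k))"
    using binomial_fact_lemma[OF kn] by (simp add: mult_ac)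
  finally show ?thesis
    using kn by simp
qed

lemma sum_permutes_image:
  fixes h :: "nat set \<Rightarrow> real"
  assumes i: "i \<le> n"
  shows "(\<Sum>j | j permutes {1..n}. h (j ` {1..i})) =
           fact i * fact (n - i) * (\<Sum>S | S \<subseteq> {1..n} \<and> card S = i. h S)"
proof -
  let ?Sub = "{T. T \<subseteq> {1..n} \<and> card T = i}"
  have fin: "finite {j. j permutes {1..n::nat}}"
    by (rule finite_permutations) simp
  have sub: "(\<lambda>j. j ` {1..i}) ` {j. j permutes {1..n}} \<subseteq> ?Sub"
  proof safe
    fix j x assume j: "j permutes {1..n}"
    show "card (j ` {1..i}) = i"
      using permutes_inj[OF j] by (subst card_image) (auto intro: inj_on_subset)
    fix y assume "y \<in> {1..i}"
    then show "j y \<in> {1..n}" using permutes_in_image[OF j, of y] i by auto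
  qed
  have "(\<Sum>j | j permutes {1..n}. h (j ` {1..i})) =
          (\<Sum>S\<in>?Sub. \<Sum>j\<in>{j \<in> {j. j permutes {1..n}}. j ` {1..i} = S}. h (j ` {1..i}))"
    using fin sub by (intro sum.group[symmetric]) auto
  also have "\<dots> = (\<Sum>S\<in>?Sub. fact i * fact (n - i) * h S)"
  proof (rule sum.cong[OF refl])
    fix S assume S: "S \<in> ?Sub"
    have "(\<Sum>j\<in>{j \<in> {j. j permutes {1..n}}. j ` {1..i} = S}. h (j ` {1..i})) =
          real (card {j. j permutes {1..n} \<and> j ` {1..i} = S}) * h S"
      by simp
    also have "\<dots> = fact i * fact (n - i) * h S"
      using card_permutes_image_eq[of S n] S by simp
    finally show "(\<Sum>j\<in>{j \<in> {j. j permutes {1..n}}. j ` {1..i} = S}. h (j ` {1..i})) =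
          fact i * fact (n - i) * h S" .
  qed
  finally show ?thesis by (simp add: sum_distrib_left)
qed

lemma order_stat_le_iff:
  assumes "1 \<le> r" "r \<le> n"
  shows "order_stat n X r \<omega> \<le> x \<longleftrightarrow> r \<le> card {i \<in> {1..n}. X i \<omega> \<le> x}"
proof -
  define ys where "ys = map (\<lambda>i. X i \<omega>) [1..<Suc n]"
  define zs where "zs = sort ys"
  have len: "length zs = n" and srt: "sorted zs" by (simp_all add: zs_def ys_def)
  have "length (filter (\<lambda>y. y \<le> x) zs) = length (filter (\<lambda>y. y \<le> x) ys)"
    by (metis mset_filter mset_sort size_mset zs_def)
  also have "\<dots> = length (filter (\<lambda>i. X i \<omega> \<le> x) [1..<Suc n])"
    by (simp add: ys_def filter_map o_def del: upt_Suc)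
  also have "\<dots> = card {i \<in> {1..n}. X i \<omega> \<le> x}"
  proof -
    have "set (filter (\<lambda>i. X i \<omega> \<le> x) [1..<Suc n]) = {i \<in> {1..n}. X i \<omega> \<le> x}"
      by auto
    then show ?thesis
      using distinct_card[of "filter (\<lambda>i. X i \<omega> \<le> x) [1..<Suc n]"] distinct_filter[OF distinct_upt]
      by (simp only: simp_thms)
  qed
  finally have cnt: "card {k. k < n \<and> zs ! k \<le> x} = card {i \<in> {1..n}. X i \<omega> \<le> x}"
    by (simp add: length_filter_conv_card len)
  have "zs ! (r - 1) \<le> x \<longleftrightarrow> r \<le> card {k. k < n \<and> zs ! k \<le> x}"
  proof
    assume le: "zs ! (r - 1) \<le> x"
    have "{..<r} \<subseteq> {k. k < n \<and> zs ! k \<le> x}"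
    proof
      fix k assume k: "k \<in> {..<r}"
      then have "zs ! k \<le> zs ! (r - 1)"
        using srt assms len by (intro sorted_nth_mono) auto
      then show "k \<in> {k. k < n \<and> zs ! k \<le> x}" using le k assms by auto
    qed
    from card_mono[OF _ this] show "r \<le> card {k. k < n \<and> zs ! k \<le> x}" by simp
  next
    assume r: "r \<le> card {k. k < n \<and> zs ! k \<le> x}"
    show "zs ! (r - 1) \<le> x"
    proof (rule ccontr)
      assume gt: "\<not> zs ! (r - 1) \<le> x"
      have "{k. k < n \<and> zs ! k \<le> x} \<subseteq> {..<r - 1}"
      proof
        fix k assume k: "k \<in> {k. k < n \<and> zs ! k \<le> x}"
        have "\<not> r - 1 \<le> k"
          using sorted_nth_mono[OF srt, of "r - 1" k] k gt len by auto
        then show "k \<in> {..<r - 1}" by simp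
      qed
      from card_mono[OF _ this] r assms show False by simp
    qed
  qed
  with cnt show ?thesis
    by (simp add: order_stat_def zs_def ys_def)
qed

section \<open>Conditional probabilities as copula derivatives\<close>

lemma abs_cont_rv_measurable: "abs_cont_rv M X \<Longrightarrow> X \<in> borel_measurable M"
  unfolding abs_cont_rv_def using distributed_measurable by fastforce

lemma (in prob_space) isCont_cdf_abs_cont:
  assumes "abs_cont_rv M Z"
  shows "isCont (cdf (distr M borel Z)) z"
proof -
  obtain f where f: "distributed M lborel Z f"
    using assms unfolding abs_cont_rv_def by blast
  interpret Q: real_distribution "distr M borel Z"
    using abs_cont_rv_measurable[OF assms] by (rule real_distribution_distr)
  have "distr M borel Z = density lborel f"
    using distributed_distr_eq_density[OF f] by (simp cong: distr_cong)
  moreover have "{z} \<in> null_sets (density lborel f)"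
  proof -
    have "{z} \<in> null_sets lborel"
      by (simp add: null_sets_def)
    then show ?thesis
      using absolutely_continuousI_density[OF distributed_borel_measurable[OF f]]
      unfolding absolutely_continuous_def by (rule subsetD[rotated])
  qed
  ultimately show ?thesis
    unfolding Q.isCont_cdf by (simp add: measure_def null_setsD1)
qed

text \<open>The bridge between the two descriptions: P(X \<le> x | Z = z) equals the partial derivative of the
  copula at (F_X(x), F_Z(z)). Integrated over a half line, both sides give P(X \<le> x, Z \<le> z), the
  right one after the substitution s = F_Z(t). The statement passes through g because the partial
  derivative itself may fail to be Borel measurable.\<close>

lemma (in prob_space) cond_prob_at_eq_copula_density:
  assumes Z: "abs_cont_rv M Z" and X: "random_variable borel X" and C: "copula_of M X Z C"
  obtains g :: "real \<Rightarrow> real" where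
    "g \<in> borel_measurable borel"
    "AE s in lborel. s \<in> {0..1} \<longrightarrow> copula_dot C (dist_fun M X x) s = g s"
    "AE z in distr M borel Z. cond_prob_at M Z {\<omega> \<in> space M. X \<omega> \<le> x} z = g (dist_fun M Z z)"
proof -
  have rvZ[measurable]: "random_variable borel Z"
    using Z by (rule abs_cont_rv_measurable)
  let ?Q = "distr M borel Z" and ?u = "dist_fun M X x"
  interpret Q: real_distribution ?Q
    using rvZ by (rule real_distribution_distr)
  interpret QX: real_distribution "distr M borel X"
    using X by (rule real_distribution_distr)
  note cont = isCont_cdf_abs_cont[OF Z]
  have u: "?u \<in> {0..1}"
    by (simp add: dist_fun_def QX.cdf_nonneg QX.cdf_bounded_prob)
  have isC: "is_copula C" and
    CX: "\<And>z. prob {\<omega> \<in> space M. X \<omega> \<le> x \<and> Z \<omega> \<le> z} = C ?u (dist_fun M Z z)"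
    using C unfolding copula_of_def by auto
  obtain g where gm[measurable]: "g \<in> borel_measurable borel" and gi: "integrable lborel g"
    and g0: "\<And>s. 0 \<le> g s"
    and gC: "\<And>w. w \<in> {0..1} \<Longrightarrow> C ?u w = (LINT t:{0..w}|lborel. g t)"
    and gdot: "AE s in lborel. s \<in> {0..1} \<longrightarrow> copula_dot C ?u s = g s"
    using copula_section_density[OF isC u] by blast
  have set_gi: "set_integrable lborel {0..1} g"
    using integrable_mult_indicator[OF _ gi, of "{0..1}"] by (simp add: set_integrable_def)
  have "AE z in ?Q. cond_prob_at M Z {\<omega> \<in> space M. X \<omega> \<le> x} z = g (dist_fun M Z z)"
  proof (rule cond_prob_at_unique[OF rvZ])
    show "{\<omega> \<in> space M. X \<omega> \<le> x} \<in> events"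
      using X by measurable
    show "integrable ?Q (\<lambda>z. g (dist_fun M Z z))"
      unfolding dist_fun_def using cont set_gi gm by (rule Q.integrable_cdf)
    fix z
    let ?w = "dist_fun M Z z"
    have w: "?w \<in> {0..1}"
      by (simp add: dist_fun_def Q.cdf_nonneg Q.cdf_bounded_prob)
    have "(LINT t:{..z}|?Q. g (dist_fun M Z t)) = (LINT t|?Q. indicator {..?w} (cdf ?Q t) * g (cdf ?Q t))"
      unfolding set_lebesgue_integral_def
    proof (rule integral_cong_AE)
      show "AE t in ?Q. indicator {..z} t *\<^sub>R g (dist_fun M Z t) = indicator {..?w} (cdf ?Q t) * g (cdf ?Q t)"
        using Q.AE_cdf_le_cdf_iff[OF cont, of z]
        by eventually_elim (auto simp: dist_fun_def indicator_def)
    qed (use Q.borel_measurable_cdf in \<open>simp_all add: dist_fun_def\<close>)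
    also have "\<dots> = (LINT s:{0..1}|lborel. indicator {..?w} s * g s)"
      by (rule Q.integral_cdf[OF cont]) measurable
    also have "\<dots> = (LINT s:{0..?w}|lborel. g s)"
      unfolding set_lebesgue_integral_def using w
      by (intro Bochner_Integration.integral_cong) (auto simp: indicator_def)
    also have "\<dots> = prob {\<omega> \<in> space M. X \<omega> \<le> x \<and> Z \<omega> \<le> z}"
      unfolding CX by (rule gC[OF w, symmetric])
    also have "{\<omega> \<in> space M. X \<omega> \<le> x \<and> Z \<omega> \<le> z} = {\<omega> \<in> {\<omega> \<in> space M. X \<omega> \<le> x}. Z \<omega> \<le> z}"
      by auto
    finally show "(LINT t:{..z}|?Q. g (dist_fun M Z t)) = prob {\<omega> \<in> {\<omega> \<in> space M. X \<omega> \<le> x}. Z \<omega> \<le> z}" .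
  qed (use g0 in auto)
  with gm gdot show ?thesis by (rule that)
qed

text \<open>Conditional independence gives the probability that exactly the variables with index in S are
  at most x as an integral over the values of Z; the substitution s = F_Z(z), uniform on [0,1],
  turns it into an integral of copula derivatives.\<close>

lemma (in prob_space) prob_exactly_below:
  assumes X: "\<And>i. i \<in> {1..n} \<Longrightarrow> random_variable borel (X i)"
    and Z: "abs_cont_rv M Z" and ci: "cond_indep_given M n X Z"
    and C: "\<And>i. i \<in> {1..n} \<Longrightarrow> copula_of M (X i) Z (C i)"
    and S: "S \<subseteq> {1..n}"
  shows "prob {\<omega> \<in> space M. {i \<in> {1..n}. X i \<omega> \<le> x} = S} =
    (LINT s:{0..1}|lebesgue.
       (\<Prod>i\<in>S. copula_dot (C i) (dist_fun M (X i) x) s) *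
       (\<Prod>i\<in>{1..n} - S. 1 - copula_dot (C i) (dist_fun M (X i) x) s))"
proof -
  let ?Q = "distr M borel Z" and ?d = "\<lambda>i. copula_dot (C i) (dist_fun M (X i) x)"
  let ?p = "\<lambda>i. cond_prob_at M Z {\<omega> \<in> space M. X i \<omega> \<le> x}"
  have rvZ: "random_variable borel Z"
    using Z by (rule abs_cont_rv_measurable)
  interpret Q: real_distribution ?Q
    using rvZ by (rule real_distribution_distr)
  have "\<forall>i\<in>{1..n}. \<exists>g. g \<in> borel_measurable borel \<and>
      (AE s in lborel. s \<in> {0..1} \<longrightarrow> ?d i s = g s) \<and> (AE z in ?Q. ?p i z = g (dist_fun M Z z))"
    (is "\<forall>i\<in>_. \<exists>g. ?P i g")
  proof
    fix i assume i: "i \<in> {1..n}"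
    from cond_prob_at_eq_copula_density[OF Z X[OF i] C[OF i], of x]
    show "\<exists>g. ?P i g" by blast
  qed
  then obtain g where gP: "\<forall>i\<in>{1..n}. ?P i (g i)"
    by (rule bchoice[THEN exE])
  then have g: "\<And>i. i \<in> {1..n} \<Longrightarrow> g i \<in> borel_measurable borel"
    and gd: "\<And>i. i \<in> {1..n} \<Longrightarrow> AE s in lborel. s \<in> {0..1} \<longrightarrow> ?d i s = g i s"
    and gp: "\<And>i. i \<in> {1..n} \<Longrightarrow> AE z in ?Q. ?p i z = g i (dist_fun M Z z)"
    by blast+
  define h where "h = (\<lambda>s. (\<Prod>i\<in>S. g i s) * (\<Prod>i\<in>{1..n} - S. 1 - g i s))"
  have h[measurable]: "h \<in> borel_measurable borel"
    unfolding h_def using g S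
    by (intro borel_measurable_times borel_measurable_prod borel_measurable_diff borel_measurable_const) auto
  have pm: "?p i \<in> borel_measurable ?Q" for i
    using cond_prob_at_measurable by simp
  have "{\<omega> \<in> space M. {i \<in> {1..n}. X i \<omega> \<le> x} = S} =
      {\<omega> \<in> space M. (\<forall>i\<in>S. X i \<omega> \<le> x) \<and> (\<forall>i\<in>{1..n} - S. \<not> X i \<omega> \<le> x)}"
    using S by auto
  then have "prob {\<omega> \<in> space M. {i \<in> {1..n}. X i \<omega> \<le> x} = S} =
      (LINT z|?Q. (\<Prod>i\<in>S. ?p i z) * (\<Prod>i\<in>{1..n} - S. 1 - ?p i z))"
    using cond_indep_given_complements[OF rvZ X ci, of "{1..n} - S" S "\<lambda>_. x"] S by auto
  also have "\<dots> = (LINT z|?Q. h (cdf ?Q z))"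
  proof (rule integral_cong_AE)
    have "AE z in ?Q. \<forall>i\<in>{1..n}. ?p i z = g i (dist_fun M Z z)"
      using gp by (intro AE_finite_allI) auto
    then show "AE z in ?Q. (\<Prod>i\<in>S. ?p i z) * (\<Prod>i\<in>{1..n} - S. 1 - ?p i z) = h (cdf ?Q z)"
    proof eventually_elim
      case (elim z)
      then show ?case
        unfolding h_def dist_fun_def using S by (intro arg_cong2[where f = "(*)"] prod.cong) auto
    qed
  next
    show "(\<lambda>z. (\<Prod>i\<in>S. ?p i z) * (\<Prod>i\<in>{1..n} - S. 1 - ?p i z)) \<in> borel_measurable ?Q"
      using pm by (intro borel_measurable_times borel_measurable_prod borel_measurable_diff borel_measurable_const)
    show "(\<lambda>z. h (cdf ?Q z)) \<in> borel_measurable ?Q"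
      using measurable_compose[OF Q.borel_measurable_cdf h] by simp
  qed
  also have "\<dots> = (LINT s:{0..1}|lborel. h s)"
    by (rule Q.integral_cdf[OF isCont_cdf_abs_cont[OF Z] h])
  also have "\<dots> = (LINT s:{0..1}|lebesgue. (\<Prod>i\<in>S. ?d i s) * (\<Prod>i\<in>{1..n} - S. 1 - ?d i s))"
  proof (rule set_integral_lebesgue_eq_lborel_AE[symmetric])
    have "AE s in lborel. \<forall>i\<in>{1..n}. s \<in> {0..1} \<longrightarrow> ?d i s = g i s"
      using gd by (intro AE_finite_allI) auto
    then show "AE s in lborel. s \<in> {0..1} \<longrightarrow> (\<Prod>i\<in>S. ?d i s) * (\<Prod>i\<in>{1..n} - S. 1 - ?d i s) = h s"
    proof (eventually_elim, intro impI)
      fix s assume "\<forall>i\<in>{1..n}. s \<in> {0..1} \<longrightarrow> ?d i s = g i s" "s \<in> {0..1::real}"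
      then show "(\<Prod>i\<in>S. ?d i s) * (\<Prod>i\<in>{1..n} - S. 1 - ?d i s) = h s"
        unfolding h_def using S by (intro arg_cong2[where f = "(*)"] prod.cong) auto
    qed
  qed (use h in auto)
  finally show ?thesis .
qed

section \<open>The distribution of an order statistic\<close>

theorem mainTheorem3:
  fixes M :: "'a measure" and X :: "nat \<Rightarrow> 'a \<Rightarrow> real" and Z :: "'a \<Rightarrow> real"
    and C :: "nat \<Rightarrow> real \<Rightarrow> real \<Rightarrow> real" and n r :: nat and x :: real
  assumes "prob_space M"
    and "\<And>i. i \<in> {1..n} \<Longrightarrow> abs_cont_rv M (X i)"
    and "abs_cont_rv M Z"
    and "cond_indep_given M n X Z"
    and "\<And>i. i \<in> {1..n} \<Longrightarrow> copula_of M (X i) Z (C i)"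
    and "1 \<le> r" and "r \<le> n"
  shows "\<P>(\<omega> in M. order_stat n X r \<omega> \<le> x) =
    (\<Sum>i=r..n. 1 / (fact i * fact (n - i)) *
      (\<Sum>j | j permutes {1..n}.
        LINT s:{0..1}|lebesgue.
          (\<Prod>l=1..i. copula_dot (C (j l)) (dist_fun M (X (j l)) x) s) *
          (\<Prod>l=i+1..n. 1 - copula_dot (C (j l)) (dist_fun M (X (j l)) x) s)))"
proof -
  interpret prob_space M by fact
  have X: "random_variable borel (X i)" if "i \<in> {1..n}" for i
    using assms(2)[OF that] by (rule abs_cont_rv_measurable)
  let ?d = "\<lambda>i. copula_dot (C i) (dist_fun M (X i) x)"
  let ?below = "\<lambda>\<omega>. {i \<in> {1..n}. X i \<omega> \<le> x}"
  define I where "I = (\<lambda>S. LINT s:{0..1}|lebesgue. (\<Prod>i\<in>S. ?d i s) * (\<Prod>i\<in>{1..n} - S. 1 - ?d i s))"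
  have ev: "{\<omega> \<in> space M. ?below \<omega> = S} \<in> events" for S
  proof (cases "S \<subseteq> {1..n}")
    case True
    have "{\<omega> \<in> space M. X i \<omega> \<le> x} \<in> events" if "i \<in> {1..n}" for i
      using X[OF that] by measurable
    then have "{\<omega> \<in> space M. \<forall>i\<in>{1..n}. X i \<omega> \<le> x \<longleftrightarrow> i \<in> S} \<in> events"
      by (intro sets.sets_Collect_finite_All sets.sets_Collect) auto
    also have "{\<omega> \<in> space M. \<forall>i\<in>{1..n}. X i \<omega> \<le> x \<longleftrightarrow> i \<in> S} = {\<omega> \<in> space M. ?below \<omega> = S}"
      using True by auto
    finally show ?thesis .
  next
    case False
    then have "{\<omega> \<in> space M. ?below \<omega> = S} = {}" by auto
    then show ?thesis by (simp only: sets.empty_sets)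
  qed
  have perm: "(\<Sum>j | j permutes {1..n}.
        LINT s:{0..1}|lebesgue. (\<Prod>l=1..i. ?d (j l) s) * (\<Prod>l=i+1..n. 1 - ?d (j l) s)) =
      fact i * fact (n - i) * (\<Sum>S | S \<subseteq> {1..n} \<and> card S = i. I S)" if i: "i \<le> n" for i
  proof -
    have "(LINT s:{0..1}|lebesgue. (\<Prod>l=1..i. ?d (j l) s) * (\<Prod>l=i+1..n. 1 - ?d (j l) s)) = I (j ` {1..i})"
      if j: "j permutes {1..n}" for j
    proof -
      have inj: "inj_on j A" for A
        using permutes_inj[OF j] by (rule inj_on_subset) simp
      have "{1..n} - j ` {1..i} = j ` {1..n} - j ` {1..i}"
        by (simp only: permutes_image[OF j])
      also have "\<dots> = j ` ({1..n} - {1..i})"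
        using permutes_inj[OF j] by (rule image_set_diff[symmetric])
      also have "{1..n} - {1..i} = {i+1..n}"
        using i by auto
      finally have "{1..n} - j ` {1..i} = j ` {i+1..n}" .
      then show ?thesis
        unfolding I_def by (simp add: prod.reindex[OF inj])
    qed
    then show ?thesis
      using sum_permutes_image[OF i, of I] by simp
  qed
  have "{\<omega> \<in> space M. order_stat n X r \<omega> \<le> x} =
      (\<Union>S\<in>{S. S \<subseteq> {1..n} \<and> card S \<in> {r..n}}. {\<omega> \<in> space M. ?below \<omega> = S})"
  proof -
    have "card (?below \<omega>) \<le> n" for \<omega>
    proof -
      have "?below \<omega> \<subseteq> {1..n}" by auto
      from card_mono[OF finite_atLeastAtMost this] show ?thesis by simp
    qed
    then show ?thesis
      by (auto simp: order_stat_le_iff[OF assms(6,7)])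
  qed
  then have "\<P>(\<omega> in M. order_stat n X r \<omega> \<le> x) =
      (\<Sum>S | S \<subseteq> {1..n} \<and> card S \<in> {r..n}. prob {\<omega> \<in> space M. ?below \<omega> = S})"
    using ev by (simp only:) (intro finite_measure_finite_Union; auto simp: disjoint_family_on_def)
  also have "\<dots> = (\<Sum>S | S \<subseteq> {1..n} \<and> card S \<in> {r..n}. I S)"
    unfolding I_def using prob_exactly_below[OF X assms(3,4,5)] by (intro sum.cong) auto
  also have "\<dots> = (\<Sum>i=r..n. \<Sum>S\<in>{S \<in> {S. S \<subseteq> {1..n} \<and> card S \<in> {r..n}}. card S = i}. I S)"
    by (intro sum.group[symmetric]) auto
  also have "\<dots> = (\<Sum>i=r..n. \<Sum>S | S \<subseteq> {1..n} \<and> card S = i. I S)"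
    by (intro sum.cong) auto
  also have "\<dots> = (\<Sum>i=r..n. 1 / (fact i * fact (n - i)) *
      (\<Sum>j | j permutes {1..n}.
        LINT s:{0..1}|lebesgue. (\<Prod>l=1..i. ?d (j l) s) * (\<Prod>l=i+1..n. 1 - ?d (j l) s)))"
    by (intro sum.cong refl) (subst perm, auto)
  finally show ?thesis .
qed

end
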